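(* Let $\mathcal{F}$ be a set of density functions (density estimation model) or signal functions (Gaussian white noise model) $f:\mathbf{R}^d\to\mathbf{R}$ with $\sup_{g\in\mathcal{F}}\|g\|_2\le B_2$, where $0<B_2<\infty$. Let $\delta>0$, let $\mathcal{F}_\delta$ be a finite $\delta$-net of $\mathcal{F}$ in the $L_2$-metric, and let $\hat f=\arg\min_{\phi\in\mathcal{F}_\delta}\gamma_n(\phi)$ be the $\delta$-net estimator. In the density estimation model assume in addition that $$\varrho(Q,\mathcal{F}_\delta)\ge 1,\qquad \sup_{f\in\mathcal{F}}\|Af\|_\infty\le B_\infty,\qquad \sup_{f\in\mathcal{F}}\|Qf\|_\infty\le B'_\infty,$$ where $0<B_\infty,B'_\infty<\infty$. Let $C_\tau>0$ and let $\xi$ satisfy $$C_\tau^{-1}\Big(\tfrac{4B'_\infty}{3}+\sqrt{2\big[\tfrac{8(B'_\infty)^2}{9}+C_\tau B_\infty\big]}\Big)\le \xi<\tfrac12\quad\text{(density estimation)},\qquad \sqrt{2/C_\tau}\le\xi<\tfrac12\quad\text{(Gaussian white noise)}.$$ Then, in both models, for every true function $f\in\mathcal{F}$, $$E\|\hat f-f\|_2^2\le C_1\delta^2+C_2\,\frac{\varrho^2(Q,\mathcal{F}_\delta)\,(\log_e(\#\mathcal{F}_\delta)+1)}{n},$$ where $C_1=(1-2\xi)^{-1}(1+2\xi)$ and $C_2=(1-2\xi)^{-1}\xi C_\tau$.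
   Context: Setting. $(\mathbf{Y},\mathcal{Y},\nu)$ is a Borel space and $A:L_2(\mathbf{R}^d)\to L_2(\mathbf{Y})$ is a known linear operator, where $L_2(\mathbf{R}^d)$ is with respect to Lebesgue measure and $L_2(\mathbf{Y})$ with respect to $\nu$; $\|\cdot\|_2$ denotes the $L_2$-norm and $\|\cdot\|_\infty$ the sup-norm. $Q=(A^{-1})^*$ is the adjoint of the inverse of $A$, with domain $L_2(\mathbf{R}^d)$: $\int_{\mathbf{R}^d}(A^{-1}h)g=\int_{\mathbf{Y}}h\,(Qg)\,d\nu$ for $h\in L_2(\mathbf{Y})$, $g\in L_2(\mathbf{R}^d)$. Density estimation model: one observes i.i.d. $Y_1,\ldots,Y_n\in\mathbf{Y}$ with common density $Af:\mathbf{Y}\to\mathbf{R}$, where $f:\mathbf{R}^d\to\mathbf{R}$ is an unknown density. Gaussian white noise model: one observes a realization of the process $dY_n(y)=(Af)(y)\,dy+n^{-1/2}dW(y)$, $y\in\mathbf{Y}$, where $W$ is the Brownian process on $\mathbf{Y}$: for $h_1,h_2\in L_2(\mathbf{Y})$, $(\int_{\mathbf{Y}} h_1dW,\int_{\mathbf{Y}} h_2dW)$ is a mean-zero Gaussian vector with variances $\|h_1\|_2^2,\|h_2\|_2^2$ and covariance $\int_{\mathbf{Y}}h_1h_2\,d\nu$; $f:\mathbf{R}^d\to\mathbf{R}$ is an unknown signal function. Empirical risk: $\gamma_n(g)=-2\int_{\mathbf{Y}}(Qg)\,dY_n+\|g\|_2^2$ (Gaussian white noise), $\gamma_n(g)=-2n^{-1}\sum_{i=1}^n(Qg)(Y_i)+\|g\|_2^2$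 (density estimation). $\delta$-net: for each $f\in\mathcal{F}$ there is $\phi\in\mathcal{F}_\delta$ with $\|f-\phi\|_2\le\delta$; $\#\mathcal{F}_\delta$ is the cardinality of $\mathcal{F}_\delta$. Operator norm over the net: $\varrho(Q,\mathcal{F}_\delta)=\max_{\phi,\phi'\in\mathcal{F}_\delta,\ \phi\ne\phi'}\dfrac{\|Q(\phi-\phi')\|_2}{\|\phi-\phi'\|_2}$.
   Formalization: In the density estimation model the δ-net is assumed to consist of elements of F; for nets with elements outside F the bound can fail, since the sup-norm bound on Qf is only assumed over F. *)

theory Defs
  imports "HOL-Probability.Probability"
begin

section \<open>Square integrable functions and operators between \<open>L\<^sub>2\<close> spaces\<close>

text \<open>
  Elements of \<open>L\<^sub>2\<close> are represented by functions. Operators act on representatives and respect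
  almost everywhere equality; all identities between functions hold almost everywhere.
\<close>

definition L2_space :: "'a measure \<Rightarrow> ('a \<Rightarrow> real) set" where
  "L2_space M = {f \<in> borel_measurable M. integrable M (\<lambda>x. (f x)\<^sup>2)}"

definition L2_norm :: "'a measure \<Rightarrow> ('a \<Rightarrow> real) \<Rightarrow> real" where
  "L2_norm M f = sqrt (\<integral>x. (f x)\<^sup>2 \<partial>M)"

definition Linf_norm :: "'a measure \<Rightarrow> ('a \<Rightarrow> real) \<Rightarrow> ereal" where
  "Linf_norm M f = esssup M (\<lambda>x. ereal \<bar>f x\<bar>)"

definition L2_linear :: "'a measure \<Rightarrow> 'b measure \<Rightarrow> (('a \<Rightarrow> real) \<Rightarrow> ('b \<Rightarrow> real)) \<Rightarrow> bool" where
  "L2_linear M N T \<longleftrightarrow>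
     (\<forall>f\<in>L2_space M. T f \<in> L2_space N) \<and>
     (\<forall>f\<in>L2_space M. \<forall>g\<in>L2_space M.
        (AE x in M. f x = g x) \<longrightarrow> (AE y in N. T f y = T g y)) \<and>
     (\<forall>f\<in>L2_space M. \<forall>g\<in>L2_space M. AE y in N. T (\<lambda>x. f x + g x) y = T f y + T g y) \<and>
     (\<forall>f\<in>L2_space M. \<forall>c. AE y in N. T (\<lambda>x. c * f x) y = c * T f y)"

definition L2_injective :: "'a measure \<Rightarrow> 'b measure \<Rightarrow> (('a \<Rightarrow> real) \<Rightarrow> ('b \<Rightarrow> real)) \<Rightarrow> bool" where
  "L2_injective M N T \<longleftrightarrow>
     (\<forall>f\<in>L2_space M. \<forall>g\<in>L2_space M.
        (AE y in N. T f y = T g y) \<longrightarrow> (AE x in M. f x = g x))"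

definition L2_range :: "'a measure \<Rightarrow> 'b measure \<Rightarrow> (('a \<Rightarrow> real) \<Rightarrow> ('b \<Rightarrow> real)) \<Rightarrow> ('b \<Rightarrow> real) set" where
  "L2_range M N T = {h \<in> L2_space N. \<exists>f\<in>L2_space M. AE y in N. T f y = h y}"

text \<open>The inverse of an injective operator; its domain is the range of the operator.\<close>

definition L2_inverse :: "'a measure \<Rightarrow> 'b measure \<Rightarrow> (('a \<Rightarrow> real) \<Rightarrow> ('b \<Rightarrow> real))
    \<Rightarrow> ('b \<Rightarrow> real) \<Rightarrow> ('a \<Rightarrow> real)" where
  "L2_inverse M N T h = (SOME f. f \<in> L2_space M \<and> (AE y in N. T f y = h y))"

text \<open>
  \<open>Q\<close> is an everywhere defined adjoint of \<open>S\<close>, where \<open>S\<close> maps the subspace \<open>D\<close> of the \<open>L\<^sub>2\<close> space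
  of \<open>N\<close> to the \<open>L\<^sub>2\<close> space of \<open>M\<close>. Linearity of \<open>Q\<close> follows from the integral identity only if
  \<open>D\<close> is dense, hence it is included.
\<close>

definition L2_adjoint :: "'b measure \<Rightarrow> 'a measure \<Rightarrow> ('b \<Rightarrow> real) set
    \<Rightarrow> (('b \<Rightarrow> real) \<Rightarrow> ('a \<Rightarrow> real)) \<Rightarrow> (('a \<Rightarrow> real) \<Rightarrow> ('b \<Rightarrow> real)) \<Rightarrow> bool" where
  "L2_adjoint N M D S Q \<longleftrightarrow>
     L2_linear M N Q \<and>
     (\<forall>h\<in>D. \<forall>g\<in>L2_space M. (\<integral>x. S h x * g x \<partial>M) = (\<integral>y. h y * Q g y \<partial>N))"


section \<open>Nets\<close>

text \<open>The elements of a net of \<open>F\<close> are not required to belong to \<open>F\<close>; where this is needed, it is assumed separately.\<close>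

definition L2_net :: "'a measure \<Rightarrow> real \<Rightarrow> ('a \<Rightarrow> real) set \<Rightarrow> ('a \<Rightarrow> real) set \<Rightarrow> bool" where
  "L2_net M \<delta> F N \<longleftrightarrow>
     N \<subseteq> L2_space M \<and> (\<forall>f\<in>F. \<exists>\<phi>\<in>N. L2_norm M (\<lambda>x. f x - \<phi> x) \<le> \<delta>)"

text \<open>
  Only used for finite nets. For a net with one element the maximum is over the empty set and
  hence an unspecified real number. Pairs of distinct functions that agree almost everywhere
  contribute \<open>0 / 0 = 0\<close> when the operator respects almost everywhere equality.
\<close>

definition net_op_norm :: "'a measure \<Rightarrow> 'b measure \<Rightarrow> (('a \<Rightarrow> real) \<Rightarrow> ('b \<Rightarrow> real))
    \<Rightarrow> ('a \<Rightarrow> real) set \<Rightarrow> real" where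
  "net_op_norm M N Q G =
     Max {L2_norm N (Q (\<lambda>x. \<phi> x - \<phi>' x)) / L2_norm M (\<lambda>x. \<phi> x - \<phi>' x) | \<phi> \<phi>'.
            \<phi> \<in> G \<and> \<phi>' \<in> G \<and> \<phi> \<noteq> \<phi>'}"


section \<open>Density estimation model\<close>

definition prob_density :: "'a measure \<Rightarrow> ('a \<Rightarrow> real) \<Rightarrow> bool" where
  "prob_density M g \<longleftrightarrow> integrable M g \<and> (AE x in M. 0 \<le> g x) \<and> (\<integral>x. g x \<partial>M) = 1"

definition iid_sample :: "'w measure \<Rightarrow> 'b measure \<Rightarrow> nat \<Rightarrow> ('b \<Rightarrow> real) \<Rightarrow> (nat \<Rightarrow> 'w \<Rightarrow> 'b) \<Rightarrow> bool" where
  "iid_sample P N n g Y \<longleftrightarrow>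
     prob_space P \<and> prob_density N g \<and>
     prob_space.indep_vars P (\<lambda>_. N) Y {1..n} \<and>
     (\<forall>i\<in>{1..n}. distributed P N (Y i) (\<lambda>y. ennreal (g y)))"

definition density_risk :: "'a measure \<Rightarrow> (('a \<Rightarrow> real) \<Rightarrow> ('b \<Rightarrow> real)) \<Rightarrow> nat \<Rightarrow> (nat \<Rightarrow> 'b)
    \<Rightarrow> ('a \<Rightarrow> real) \<Rightarrow> real" where
  "density_risk M Q n y g = - 2 * (1 / real n) * (\<Sum>i=1..n. Q g (y i)) + (L2_norm M g)\<^sup>2"


section \<open>Gaussian white noise model\<close>

definition gaussian_law :: "real measure \<Rightarrow> bool" where
  "gaussian_law \<mu> \<longleftrightarrow>
     (\<exists>m \<sigma>. 0 < \<sigma> \<and> \<mu> = density lborel (\<lambda>x. ennreal (normal_density m \<sigma> x))) \<or>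
     (\<exists>m. \<mu> = return borel m)"

text \<open>
  A random vector is Gaussian if all linear combinations of its components are normally
  distributed, where point masses count as normal distributions.
\<close>

definition gaussian_pair :: "'w measure \<Rightarrow> ('w \<Rightarrow> real) \<Rightarrow> ('w \<Rightarrow> real) \<Rightarrow> bool" where
  "gaussian_pair P U V \<longleftrightarrow>
     U \<in> borel_measurable P \<and> V \<in> borel_measurable P \<and>
     (\<forall>a b. gaussian_law (distr P borel (\<lambda>\<omega>. a * U \<omega> + b * V \<omega>)))"

text \<open>\<open>W h\<close> is the stochastic integral of \<open>h\<close> with respect to the Brownian process.\<close>

definition brownian_process :: "'w measure \<Rightarrow> 'b measure \<Rightarrow> (('b \<Rightarrow> real) \<Rightarrow> 'w \<Rightarrow> real) \<Rightarrow> bool" where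
  "brownian_process P N W \<longleftrightarrow>
     prob_space P \<and>
     (\<forall>h1\<in>L2_space N. \<forall>h2\<in>L2_space N.
        gaussian_pair P (W h1) (W h2) \<and>
        prob_space.expectation P (W h1) = 0 \<and>
        prob_space.expectation P (W h2) = 0 \<and>
        prob_space.variance P (W h1) = (L2_norm N h1)\<^sup>2 \<and>
        prob_space.variance P (W h2) = (L2_norm N h2)\<^sup>2 \<and>
        prob_space.expectation P (\<lambda>\<omega>. W h1 \<omega> * W h2 \<omega>) = (\<integral>y. h1 y * h2 y \<partial>N))"

text \<open>
  The integral of \<open>h\<close> against the observed process with drift \<open>g\<close>, that is, against
  \<open>g d\<nu> + n\<^sup>-\<^sup>1\<^sup>/\<^sup>2 dW\<close>.
\<close>

definition white_noise_obs :: "'b measure \<Rightarrow> nat \<Rightarrow> ('b \<Rightarrow> real) \<Rightarrow> (('b \<Rightarrow> real) \<Rightarrow> 'w \<Rightarrow> real)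
    \<Rightarrow> 'w \<Rightarrow> ('b \<Rightarrow> real) \<Rightarrow> real" where
  "white_noise_obs N n g W \<omega> h = (\<integral>y. h y * g y \<partial>N) + real n powr (- 1 / 2) * W h \<omega>"

text \<open>The argument \<open>y\<close> maps \<open>h\<close> to the integral of \<open>h\<close> against the observed process.\<close>

definition white_noise_risk :: "'a measure \<Rightarrow> (('a \<Rightarrow> real) \<Rightarrow> ('b \<Rightarrow> real)) \<Rightarrow> (('b \<Rightarrow> real) \<Rightarrow> real)
    \<Rightarrow> ('a \<Rightarrow> real) \<Rightarrow> real" where
  "white_noise_risk M Q y g = - 2 * y (Q g) + (L2_norm M g)\<^sup>2"


section \<open>Minimum risk estimators over a net\<close>

text \<open>
  \<open>\<gamma> \<omega> \<phi>\<close> is the empirical risk of \<open>\<phi>\<close> at the outcome \<open>\<omega>\<close>. Minimizers need not be unique, so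
  measurability of the selected minimizer is required.
\<close>

definition net_estimator :: "'w measure \<Rightarrow> ('a \<Rightarrow> real) set \<Rightarrow> ('w \<Rightarrow> ('a \<Rightarrow> real) \<Rightarrow> real)
    \<Rightarrow> ('w \<Rightarrow> ('a \<Rightarrow> real)) \<Rightarrow> bool" where
  "net_estimator P G \<gamma> fhat \<longleftrightarrow>
     fhat \<in> P \<rightarrow>\<^sub>M count_space G \<and>
     (\<forall>\<omega>\<in>space P. is_arg_min (\<gamma> \<omega>) (\<lambda>\<phi>. \<phi> \<in> G) (fhat \<omega>))"

end

theory Submission
  imports Defs
begin

text \<open>
  Let \<open>Z \<phi>\<close> be the noise part of the observed functional of \<open>Q \<phi>\<close>, and let \<open>\<phi>0\<close> be a point of the net
  within \<open>\<delta>\<close> of \<open>f\<close>. Comparing the risks of the estimator \<open>\<phi>\<close> and of \<open>\<phi>0\<close> gives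
  \<open>(1 - 2\<xi>) \<parallel>\<phi> - f\<parallel>\<^sup>2 \<le> (1 + 2\<xi>) \<delta>\<^sup>2 + X \<phi>\<close> with
  \<open>X \<phi> = 2 (Z \<phi> - Z \<phi>0) - \<xi> \<parallel>\<phi> - \<phi>0\<parallel>\<^sup>2\<close>.
  At the scale \<open>c = \<xi> C\<tau> \<rho>\<^sup>2 / n\<close> the condition on \<open>\<xi>\<close> is what makes the quadratic penalty absorb
  the Gaussian, respectively Bernstein, bound for the moment generating function, so that
  \<open>E exp (X \<phi> / c) \<le> 1\<close> for every point of the net. Then \<open>x \<le> exp (x - L) + L - 1\<close> with
  \<open>L = ln #F\<delta>\<close>, summed over the net, bounds the expectation of \<open>X\<close> at the estimator by \<open>c L\<close>.
\<close>


section \<open>Square integrable functions\<close>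

lemma L2_space_integrable_mult:
  assumes "f \<in> L2_space M" "g \<in> L2_space M"
  shows "integrable M (\<lambda>x. f x * g x)"
proof -
  have m: "f \<in> borel_measurable M" "g \<in> borel_measurable M"
    and int: "integrable M (\<lambda>x. (f x)\<^sup>2 + (g x)\<^sup>2)"
    using assms by (auto simp: L2_space_def)
  have "norm (f x * g x) \<le> norm ((f x)\<^sup>2 + (g x)\<^sup>2)" for x
  proof -
    have "0 \<le> (\<bar>f x\<bar> - \<bar>g x\<bar>)\<^sup>2" by simp
    then have "2 * (\<bar>f x\<bar> * \<bar>g x\<bar>) \<le> (f x)\<^sup>2 + (g x)\<^sup>2"
      by (simp add: power2_diff)
    moreover have "0 \<le> \<bar>f x\<bar> * \<bar>g x\<bar>" by simp
    ultimately show ?thesis unfolding real_norm_def abs_mult by linarith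
  qed
  then show ?thesis
    by (intro Bochner_Integration.integrable_bound[OF int borel_measurable_times[OF m]] AE_I2)
qed

lemma L2_norm_nonneg: "0 \<le> L2_norm M f"
  by (simp add: L2_norm_def)

lemma L2_norm_power2: "(L2_norm M f)\<^sup>2 = (\<integral>x. (f x)\<^sup>2 \<partial>M)"
  by (simp add: L2_norm_def)

lemma L2_norm_cong_AE:
  assumes "AE x in M. f x = g x" "f \<in> borel_measurable M" "g \<in> borel_measurable M"
  shows "L2_norm M f = L2_norm M g"
  unfolding L2_norm_def using assms by (intro arg_cong[of _ _ sqrt] integral_cong_AE) auto

lemma L2_space_scale:
  assumes "f \<in> L2_space M" shows "(\<lambda>x. c * f x) \<in> L2_space M"
  using assms by (auto simp: L2_space_def power_mult_distrib)

lemma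
  assumes "f \<in> L2_space M" "g \<in> L2_space M"
  shows L2_space_diff: "(\<lambda>x. f x - g x) \<in> L2_space M"
    and L2_norm_diff_power2: "(L2_norm M (\<lambda>x. f x - g x))\<^sup>2
      = (L2_norm M f)\<^sup>2 - 2 * (\<integral>x. f x * g x \<partial>M) + (L2_norm M g)\<^sup>2"
proof -
  have sq: "(\<lambda>x. (f x - g x)\<^sup>2) = (\<lambda>x. (f x)\<^sup>2 - 2 * (f x * g x) + (g x)\<^sup>2)"
    by (auto simp: power2_diff)
  have i: "integrable M (\<lambda>x. (f x)\<^sup>2)" "integrable M (\<lambda>x. (g x)\<^sup>2)"
    "integrable M (\<lambda>x. f x * g x)"
    using assms L2_space_integrable_mult[OF assms] by (auto simp: L2_space_def)
  then have i4: "integrable M (\<lambda>x. 2 * (f x * g x))" by simp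
  from i have "integrable M (\<lambda>x. (f x - g x)\<^sup>2)"
    unfolding sq by simp
  then show "(\<lambda>x. f x - g x) \<in> L2_space M"
    using assms by (auto simp: L2_space_def)
  show "(L2_norm M (\<lambda>x. f x - g x))\<^sup>2
      = (L2_norm M f)\<^sup>2 - 2 * (\<integral>x. f x * g x \<partial>M) + (L2_norm M g)\<^sup>2"
    unfolding L2_norm_power2 sq
    using Bochner_Integration.integral_add[OF Bochner_Integration.integrable_diff[OF i(1) i4] i(2)]
      Bochner_Integration.integral_diff[OF i(1) i4]
    by (simp only: integral_mult_right_zero)
qed

text \<open>Integrating \<open>(a - c)^2 \<le> 2 * (a - b)^2 + 2 * (b - c)^2\<close> pointwise gives
  the squared form at once. The factor 2 here is the source of the factors
  \<open>1 - 2 * \<xi>\<close> and \<open>1 + 2 * \<xi>\<close> in the final bound.\<close>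

lemma L2_norm_diff_power2_triangle:
  assumes "f \<in> L2_space M" "g \<in> L2_space M" "h \<in> L2_space M"
  shows "(L2_norm M (\<lambda>x. f x - h x))\<^sup>2
    \<le> 2 * (L2_norm M (\<lambda>x. f x - g x))\<^sup>2 + 2 * (L2_norm M (\<lambda>x. g x - h x))\<^sup>2"
proof -
  have [simp]: "integrable M (\<lambda>x. (f x - h x)\<^sup>2)" "integrable M (\<lambda>x. (f x - g x)\<^sup>2)"
    "integrable M (\<lambda>x. (g x - h x)\<^sup>2)"
    using L2_space_diff[OF assms(1,3)] L2_space_diff[OF assms(1,2)] L2_space_diff[OF assms(2,3)]
    by (auto simp: L2_space_def)
  have "(a - c)\<^sup>2 \<le> 2 * (a - b)\<^sup>2 + 2 * (b - c)\<^sup>2" for a b c :: real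
  proof -
    have "2 * (a - b)\<^sup>2 + 2 * (b - c)\<^sup>2 - (a - c)\<^sup>2 = (a - 2 * b + c)\<^sup>2"
      by algebra
    then show ?thesis by (metis diff_ge_0_iff_ge zero_le_power2)
  qed
  then have "(\<integral>x. (f x - h x)\<^sup>2 \<partial>M) \<le> (\<integral>x. 2 * (f x - g x)\<^sup>2 + 2 * (g x - h x)\<^sup>2 \<partial>M)"
    by (intro integral_mono) auto
  then show ?thesis unfolding L2_norm_power2 by simp
qed

section \<open>Linear operators between L2 spaces, the adjoint of the inverse, and the operator norm
  over a net\<close>

lemma
  assumes T: "L2_linear M N T" and f: "f \<in> L2_space M"
  shows L2_linear_space: "T f \<in> L2_space N"
    and L2_linear_cong: "g \<in> L2_space M \<Longrightarrow> AE x in M. f x = g x \<Longrightarrow> AE y in N. T f y = T g y"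
    and L2_linear_add: "g \<in> L2_space M \<Longrightarrow> AE y in N. T (\<lambda>x. f x + g x) y = T f y + T g y"
    and L2_linear_scale: "AE y in N. T (\<lambda>x. c * f x) y = c * T f y"
  using assms unfolding L2_linear_def by auto

lemma L2_linear_diff:
  assumes T: "L2_linear M N T" and f: "f \<in> L2_space M" and g: "g \<in> L2_space M"
  shows "AE y in N. T (\<lambda>x. f x - g x) y = T f y - T g y"
proof -
  have m: "(\<lambda>x. (-1) * g x) \<in> L2_space M" using g by (rule L2_space_scale)
  have "AE y in N. T (\<lambda>x. (-1) * g x) y = (-1) * T g y"
    by (rule L2_linear_scale[OF T g])
  moreover have "AE y in N. T (\<lambda>x. f x + (-1) * g x) y = T f y + T (\<lambda>x. (-1) * g x) y"
    by (rule L2_linear_add[OF T f m])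
  ultimately have "AE y in N. T (\<lambda>x. f x + (-1) * g x) y = T f y - T g y"
    by eventually_elim simp
  then show ?thesis by simp
qed

text \<open>A function of norm 0 agrees almost everywhere with \<open>0 * f\<close>, so homogeneity
  with the scalar 0 applies. This covers distinct net points that are equal almost everywhere: there
  the quotient in \<open>net_op_norm\<close> is division by zero and carries no information.\<close>

lemma L2_linear_norm_eq_0:
  assumes T: "L2_linear M N T" and f: "f \<in> L2_space M" and 0: "L2_norm M f = 0"
  shows "L2_norm N (T f) = 0"
proof -
  have "(\<integral>x. (f x)\<^sup>2 \<partial>M) = 0" "integrable M (\<lambda>x. (f x)\<^sup>2)"
    using 0 f by (auto simp: L2_norm_def L2_space_def)
  then have "AE x in M. f x = 0 * f x"
    by (simp add: integral_nonneg_eq_0_iff_AE)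
  then have "AE y in N. T f y = T (\<lambda>x. 0 * f x) y"
    by (rule L2_linear_cong[OF T f L2_space_scale[OF f]])
  moreover have "AE y in N. T (\<lambda>x. 0 * f x) y = 0 * T f y"
    by (rule L2_linear_scale[OF T f])
  ultimately have "AE y in N. T f y = 0" by eventually_elim simp
  moreover have "T f \<in> borel_measurable N"
    using T f by (auto simp: L2_linear_def L2_space_def)
  ultimately have "L2_norm N (T f) = L2_norm N (\<lambda>_. 0)"
    by (intro L2_norm_cong_AE) auto
  then show ?thesis by (simp add: L2_norm_def)
qed

text \<open>The function chosen by \<open>L2_inverse\<close> at \<open>A f\<close> is a preimage of
  \<open>A f\<close>, hence equals \<open>f\<close> almost everywhere by injectivity, and the
  adjoint identity applies with \<open>h = A f\<close>. The consequence is that the mean of the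
  observed functional of \<open>Q g\<close> is the inner product of \<open>f\<close> and
  \<open>g\<close>, so the mean empirical risk of \<open>g\<close> is the squared distance from
  \<open>g\<close> to \<open>f\<close> up to a constant.\<close>

lemma L2_adjoint_inverse_integral:
  assumes A: "L2_linear M N A" and inj: "L2_injective M N A"
    and Q: "L2_adjoint N M (L2_range M N A) (L2_inverse M N A) Q"
    and f: "f \<in> L2_space M" and g: "g \<in> L2_space M"
  shows "(\<integral>y. Q g y * A f y \<partial>N) = (\<integral>x. f x * g x \<partial>M)"
proof -
  let ?f = "L2_inverse M N A (A f)"
  have range: "A f \<in> L2_range M N A"
    unfolding L2_range_def using L2_linear_space[OF A f] f by auto
  have adj: "(\<integral>y. h y * Q g y \<partial>N) = (\<integral>x. L2_inverse M N A h x * g x \<partial>M)"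
    if "h \<in> L2_range M N A" for h
    using Q g that unfolding L2_adjoint_def by simp
  have "?f \<in> L2_space M \<and> (AE y in N. A ?f y = A f y)"
    unfolding L2_inverse_def using f by (rule someI[of _ f, OF conjI]) simp
  then have L2: "?f \<in> L2_space M" and ae: "AE x in M. ?f x = f x"
    using inj f unfolding L2_injective_def by blast+
  have "(\<integral>y. Q g y * A f y \<partial>N) = (\<integral>y. A f y * Q g y \<partial>N)"
    by (simp only: mult.commute)
  also have "\<dots> = (\<integral>x. ?f x * g x \<partial>M)"
    by (rule adj[OF range])
  also have "\<dots> = (\<integral>x. f x * g x \<partial>M)"
  proof (rule integral_cong_AE)
    show "AE x in M. ?f x * g x = f x * g x" using ae by eventually_elim simp
  qed (use f g L2 in \<open>auto simp: L2_space_def\<close>)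
  finally show ?thesis .
qed

text \<open>For distinct points this is the definition of the maximum, multiplied out. Equal points
  are treated apart since the maximum runs over distinct pairs; thus the bound also holds on a
  one-point net, where \<open>net_op_norm\<close> is an unspecified real.\<close>

lemma net_op_norm_bound:
  assumes Q: "L2_linear M N Q" and G: "G \<subseteq> L2_space M" "finite G"
    and \<phi>: "\<phi> \<in> G" "\<phi>' \<in> G"
  shows "(L2_norm N (\<lambda>y. Q \<phi> y - Q \<phi>' y))\<^sup>2
    \<le> (net_op_norm M N Q G)\<^sup>2 * (L2_norm M (\<lambda>x. \<phi> x - \<phi>' x))\<^sup>2"
proof (cases "\<phi> = \<phi>'")
  case True
  then show ?thesis by (simp add: L2_norm_def)
next
  case False
  let ?q = "L2_norm N (Q (\<lambda>x. \<phi> x - \<phi>' x))" and ?w = "L2_norm M (\<lambda>x. \<phi> x - \<phi>' x)"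
  let ?S = "{L2_norm N (Q (\<lambda>x. \<phi> x - \<phi>' x)) / L2_norm M (\<lambda>x. \<phi> x - \<phi>' x) | \<phi> \<phi>'.
            \<phi> \<in> G \<and> \<phi>' \<in> G \<and> \<phi> \<noteq> \<phi>'}"
  have d: "(\<lambda>x. \<phi> x - \<phi>' x) \<in> L2_space M"
    using G \<phi> by (auto intro: L2_space_diff)
  have "?S \<subseteq> (\<lambda>(\<phi>, \<phi>'). L2_norm N (Q (\<lambda>x. \<phi> x - \<phi>' x)) / L2_norm M (\<lambda>x. \<phi> x - \<phi>' x)) ` (G \<times> G)"
    by auto
  then have "finite ?S" by (rule finite_subset) (simp add: G(2))
  then have "?q / ?w \<le> net_op_norm M N Q G"
    unfolding net_op_norm_def using \<phi> False by (intro Max_ge) auto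
  then have "?q \<le> net_op_norm M N Q G * ?w"
    using L2_linear_norm_eq_0[OF Q d] L2_norm_nonneg[of M "\<lambda>x. \<phi> x - \<phi>' x"]
    by (cases "?w = 0") (auto simp: divide_le_eq)
  then have "?q\<^sup>2 \<le> (net_op_norm M N Q G)\<^sup>2 * ?w\<^sup>2"
    unfolding power_mult_distrib[symmetric] by (rule power_mono[OF _ L2_norm_nonneg])
  moreover have "?q = L2_norm N (\<lambda>y. Q \<phi> y - Q \<phi>' y)"
  proof (rule L2_norm_cong_AE[OF L2_linear_diff[OF Q]])
    show "Q (\<lambda>x. \<phi> x - \<phi>' x) \<in> borel_measurable N"
      using Q d by (auto simp: L2_linear_def L2_space_def)
    have "Q \<phi> \<in> borel_measurable N" "Q \<phi>' \<in> borel_measurable N"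
      using Q \<phi> G by (auto simp: L2_linear_def L2_space_def)
    then show "(\<lambda>y. Q \<phi> y - Q \<phi>' y) \<in> borel_measurable N" by measurable
  qed (use \<phi> G in auto)
  ultimately show ?thesis by simp
qed

lemma Linf_norm_AE_bound:
  assumes "Linf_norm M f \<le> ereal b"
  shows "AE x in M. \<bar>f x\<bar> \<le> b"
  using esssup_AE[where M = M and f = "\<lambda>x. ereal \<bar>f x\<bar>"]
proof eventually_elim
  case (elim x)
  then have "ereal \<bar>f x\<bar> \<le> ereal b" using assms unfolding Linf_norm_def by (rule order_trans)
  then show ?case by simp
qed


section \<open>Minimizers of the empirical risk\<close>

text \<open>Adding the squared norm of \<open>f\<close> to both sides of \<open>min\<close>
  completes the squares: the squared distance of \<open>\<phi>\<close> to \<open>f\<close>, minus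
  \<open>2 * z\<close>, is at most that of \<open>\<phi>0\<close>, minus \<open>2 * z0\<close>. The
  penalty is then subtracted on the right and paid for by the squared triangle inequality through
  \<open>f\<close>. The reals \<open>z\<close> and \<open>z0\<close> are arbitrary, so one
  deterministic statement serves both models.\<close>

lemma penalized_oracle_inequality:
  assumes f: "f \<in> L2_space M" and \<phi>: "\<phi> \<in> L2_space M" and \<phi>0: "\<phi>0 \<in> L2_space M"
    and near: "L2_norm M (\<lambda>x. f x - \<phi>0 x) \<le> \<delta>" and \<xi>: "0 \<le> \<xi>"
    and min: "- 2 * ((\<integral>x. f x * \<phi> x \<partial>M) + z) + (L2_norm M \<phi>)\<^sup>2
      \<le> - 2 * ((\<integral>x. f x * \<phi>0 x \<partial>M) + z0) + (L2_norm M \<phi>0)\<^sup>2"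
  shows "(1 - 2 * \<xi>) * (L2_norm M (\<lambda>x. \<phi> x - f x))\<^sup>2
    \<le> (1 + 2 * \<xi>) * \<delta>\<^sup>2 + (2 * (z - z0) - \<xi> * (L2_norm M (\<lambda>x. \<phi> x - \<phi>0 x))\<^sup>2)"
proof -
  have d: "(L2_norm M (\<lambda>x. f x - \<phi>0 x))\<^sup>2 \<le> \<delta>\<^sup>2"
    using near by (intro power_mono L2_norm_nonneg)
  have "\<xi> * (L2_norm M (\<lambda>x. \<phi> x - \<phi>0 x))\<^sup>2
      \<le> \<xi> * (2 * (L2_norm M (\<lambda>x. \<phi> x - f x))\<^sup>2 + 2 * (L2_norm M (\<lambda>x. f x - \<phi>0 x))\<^sup>2)"
    by (intro mult_left_mono \<xi> L2_norm_diff_power2_triangle f \<phi> \<phi>0)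
  moreover have "\<xi> * (L2_norm M (\<lambda>x. f x - \<phi>0 x))\<^sup>2 \<le> \<xi> * \<delta>\<^sup>2"
    using d \<xi> by (rule mult_left_mono)
  moreover have "(L2_norm M (\<lambda>x. \<phi> x - f x))\<^sup>2 - 2 * z \<le> (L2_norm M (\<lambda>x. f x - \<phi>0 x))\<^sup>2 - 2 * z0"
    using min by (simp add: L2_norm_diff_power2 f \<phi> \<phi>0 mult.commute)
  ultimately show ?thesis using d by (simp add: algebra_simps)
qed

text \<open>The selected index depends on the outcome, so \<open>X (s \<omega>) \<omega>\<close>
  cannot be treated as a fixed variable. Its exponential is dominated by the sum over all of
  \<open>G\<close>, which no longer mentions \<open>s\<close>. After the shift by
  \<open>L = ln (card G)\<close> that sum has expectation at most 1, which cancels the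
  \<open>- 1\<close> and leaves \<open>K + c * L\<close>.\<close>

lemma (in prob_space) expectation_selection_le:
  fixes D :: "'b \<Rightarrow> real" and X :: "'b \<Rightarrow> 'a \<Rightarrow> real"
  assumes G: "finite G" and s: "s \<in> M \<rightarrow>\<^sub>M count_space G" and c: "0 < c"
    and D: "AE \<omega> in M. D (s \<omega>) \<le> K + X (s \<omega>) \<omega>"
    and int: "\<And>\<phi>. \<phi> \<in> G \<Longrightarrow> integrable M (\<lambda>\<omega>. exp (X \<phi> \<omega> / c))"
    and le1: "\<And>\<phi>. \<phi> \<in> G \<Longrightarrow> expectation (\<lambda>\<omega>. exp (X \<phi> \<omega> / c)) \<le> 1"
  shows "expectation (\<lambda>\<omega>. D (s \<omega>)) \<le> K + c * ln (real (card G))"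
proof -
  define L where "L = ln (real (card G))"
  have sG: "s \<omega> \<in> G" if "\<omega> \<in> space M" for \<omega>
    using measurable_space[OF s that] by simp
  then have "G \<noteq> {}" using not_empty by auto
  then have N: "0 < card G" using G by (simp add: card_gt_0_iff)
  then have eL: "exp L = card G" by (simp add: L_def)
  let ?B = "\<lambda>\<omega>. K + c * ((\<Sum>\<phi>\<in>G. exp (X \<phi> \<omega> / c)) / card G + L - 1)"
  have "AE \<omega> in M. D (s \<omega>) \<le> ?B \<omega>"
    using D AE_space
  proof eventually_elim
    case (elim \<omega>)
    \<comment> \<open>The shift by \<open>L\<close> inside \<open>exp\<close> is what produces the
      factor \<open>1 / card G\<close> that averages the sum.\<close>
    have "1 + (X (s \<omega>) \<omega> / c - L) \<le> exp (X (s \<omega>) \<omega> / c - L)" by (rule exp_ge_add_one_self)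
    also have "\<dots> = exp (X (s \<omega>) \<omega> / c) / card G" by (simp add: exp_diff eL)
    also have "\<dots> \<le> (\<Sum>\<phi>\<in>G. exp (X \<phi> \<omega> / c)) / card G"
      using sG[OF elim(2)] G by (intro divide_right_mono member_le_sum) auto
    finally have "X (s \<omega>) \<omega> / c \<le> (\<Sum>\<phi>\<in>G. exp (X \<phi> \<omega> / c)) / card G + L - 1" by simp
    then have "X (s \<omega>) \<omega> \<le> c * ((\<Sum>\<phi>\<in>G. exp (X \<phi> \<omega> / c)) / card G + L - 1)"
      using c by (simp add: divide_le_eq mult.commute)
    then show ?case using elim(1) by linarith
  qed
  \<comment> \<open>Only finitely many values occur, so the left side is bounded.\<close>
  moreover have "integrable M (\<lambda>\<omega>. D (s \<omega>))"
  proof (rule integrable_const_bound)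
    show "AE \<omega> in M. norm (D (s \<omega>)) \<le> (\<Sum>\<phi>\<in>G. \<bar>D \<phi>\<bar>)"
      using sG G by (auto intro!: member_le_sum)
    show "(\<lambda>\<omega>. D (s \<omega>)) \<in> borel_measurable M"
      by (rule measurable_compose[OF s]) simp
  qed
  ultimately have "expectation (\<lambda>\<omega>. D (s \<omega>)) \<le> expectation ?B"
    using int by (intro integral_mono_AE) auto
  also have "\<dots> = K + c * ((\<Sum>\<phi>\<in>G. expectation (\<lambda>\<omega>. exp (X \<phi> \<omega> / c))) / card G + L - 1)"
    using int by (simp add: prob_space)
  also have "\<dots> \<le> K + c * (real (card G) / card G + L - 1)"
  proof -
    have "(\<Sum>\<phi>\<in>G. expectation (\<lambda>\<omega>. exp (X \<phi> \<omega> / c))) \<le> (\<Sum>\<phi>\<in>G. 1)"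
      by (intro sum_mono le1)
    then have "(\<Sum>\<phi>\<in>G. expectation (\<lambda>\<omega>. exp (X \<phi> \<omega> / c))) / card G \<le> real (card G) / card G"
      by (intro divide_right_mono) auto
    then show ?thesis using c by simp
  qed
  finally show ?thesis using N by (simp add: L_def)
qed


section \<open>Exponential moments\<close>

text \<open>The factorial of \<open>k + 2\<close> is at least \<open>2 * 3 ^ k\<close>, because
  after the factor 2 come \<open>k\<close> factors that are at least 3. The exponential series from
  its quadratic term on is therefore dominated by a geometric series of ratio
  \<open>a / 3\<close>.\<close>

lemma exp_le_bernstein:
  fixes x :: real
  assumes x: "\<bar>x\<bar> \<le> a" and a: "a < 3"
  shows "exp x \<le> 1 + x + x\<^sup>2 / 2 / (1 - a / 3)"
proof -
  have a0: "0 \<le> a" using x by linarith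
  have fact: "2 * 3 ^ k \<le> (fact (k + 2) :: real)" for k
  proof (induction k)
    case (Suc k)
    have "2 * 3 ^ Suc k = 3 * (2 * 3 ^ k :: real)" by simp
    also have "\<dots> \<le> (of_nat (k + 3)) * fact (k + 2)"
      using Suc by (intro mult_mono) auto
    also have "\<dots> = fact (Suc k + 2)" by (simp add: algebra_simps)
    finally show ?case .
  qed (simp add: fact_numeral)
  have le: "inverse (fact (k + 2)) *\<^sub>R x ^ (k + 2) \<le> x\<^sup>2 / 2 * (a / 3) ^ k" for k
  proof -
    have "inverse (fact (k + 2)) *\<^sub>R x ^ (k + 2) \<le> inverse (fact (k + 2)) * \<bar>x ^ (k + 2)\<bar>"
      by (simp add: mult_left_mono)
    also have "\<dots> = inverse (fact (k + 2)) * (x\<^sup>2 * \<bar>x\<bar> ^ k)"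
      unfolding power_add abs_mult by (simp add: power_abs)
    also have "\<dots> \<le> inverse (2 * 3 ^ k) * (x\<^sup>2 * a ^ k)"
    proof (rule mult_mono)
      show "inverse (fact (k + 2)) \<le> inverse (2 * 3 ^ k :: real)"
        using fact[of k] by (rule le_imp_inverse_le) simp
      show "x\<^sup>2 * \<bar>x\<bar> ^ k \<le> x\<^sup>2 * a ^ k"
        using x by (simp add: mult_left_mono power_mono)
    qed simp_all
    also have "\<dots> = x\<^sup>2 / 2 * (a / 3) ^ k"
      by (simp add: power_divide) (simp add: divide_inverse)
    finally show ?thesis .
  qed
  have geo: "(\<lambda>k. x\<^sup>2 / 2 * (a / 3) ^ k) sums (x\<^sup>2 / 2 * (1 / (1 - a / 3)))"
    using a a0 by (intro sums_mult geometric_sums) auto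
  have "exp x = 1 + x + (\<Sum>k. inverse (fact (k + 2)) *\<^sub>R x ^ (k + 2))"
    by (rule exp_first_two_terms)
  also have "\<dots> \<le> 1 + x + (\<Sum>k. x\<^sup>2 / 2 * (a / 3) ^ k)"
    using le summable_ignore_initial_segment[OF summable_exp_generic[of x], where k = 2] sums_summable[OF geo]
    by (intro add_left_mono suminf_le) auto
  also have "\<dots> = 1 + x + x\<^sup>2 / 2 / (1 - a / 3)"
    using sums_unique[OF geo] by simp
  finally show ?thesis .
qed

text \<open>The exponential is bounded before centring, which keeps the envelope at \<open>b\<close>
  instead of \<open>2 * b\<close>. The linear term is moved into the exponent by
  \<open>1 + u \<le> exp u\<close> and there cancels exactly against the factor
  \<open>exp (- s * expectation X)\<close>. Accordingly \<open>v\<close> bounds the raw second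
  moment.\<close>

lemma (in prob_space)
  fixes X :: "'a \<Rightarrow> real"
  assumes [measurable]: "X \<in> borel_measurable M" and b: "AE \<omega> in M. \<bar>X \<omega>\<bar> \<le> b"
    and v: "expectation (\<lambda>\<omega>. (X \<omega>)\<^sup>2) \<le> v" and s: "0 \<le> s" "s * b < 3"
  shows bernstein_mgf_integrable: "integrable M (\<lambda>\<omega>. exp (s * (X \<omega> - expectation X)))"
    and bernstein_mgf: "expectation (\<lambda>\<omega>. exp (s * (X \<omega> - expectation X)))
      \<le> exp (s\<^sup>2 * v / 2 / (1 - s * b / 3))"
proof -
  have sX: "AE \<omega> in M. \<bar>s * X \<omega>\<bar> \<le> s * b"
    using b by eventually_elim (use s in \<open>simp add: abs_mult mult_left_mono\<close>)
  have iX: "integrable M X"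
    using b by (intro integrable_const_bound) auto
  have iX2: "integrable M (\<lambda>\<omega>. (X \<omega>)\<^sup>2)"
  proof (rule integrable_const_bound)
    show "AE \<omega> in M. norm ((X \<omega>)\<^sup>2) \<le> b\<^sup>2"
      using b
    proof eventually_elim
      case (elim \<omega>)
      from power_mono[OF elim abs_ge_zero, of 2] show ?case by simp
    qed
  qed measurable
  have iE: "integrable M (\<lambda>\<omega>. exp (s * X \<omega>))"
    using sX by (intro integrable_const_bound[of _ "exp (s * b)"]) (auto elim!: eventually_mono)
  have eq: "exp (s * (X \<omega> - expectation X)) = exp (s * X \<omega>) * exp (- s * expectation X)" for \<omega>
    by (simp add: exp_add[symmetric] algebra_simps)
  show "integrable M (\<lambda>\<omega>. exp (s * (X \<omega> - expectation X)))"
    unfolding eq using iE by simp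
  have p: "0 < 1 - s * b / 3" using s by simp
  have "expectation (\<lambda>\<omega>. exp (s * X \<omega>))
      \<le> expectation (\<lambda>\<omega>. 1 + s * X \<omega> + s\<^sup>2 / 2 / (1 - s * b / 3) * (X \<omega>)\<^sup>2)"
  proof (rule integral_mono_AE)
    show "AE \<omega> in M. exp (s * X \<omega>) \<le> 1 + s * X \<omega> + s\<^sup>2 / 2 / (1 - s * b / 3) * (X \<omega>)\<^sup>2"
      using sX
    proof eventually_elim
      case (elim \<omega>)
      show ?case using exp_le_bernstein[OF elim s(2)] by (simp add: power_mult_distrib)
    qed
  qed (use iX iX2 iE in auto)
  also have "\<dots> = 1 + (s * expectation X + s\<^sup>2 / 2 / (1 - s * b / 3) * expectation (\<lambda>\<omega>. (X \<omega>)\<^sup>2))"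
    using iX iX2 by (simp add: prob_space)
  also have "\<dots> \<le> exp (s * expectation X + s\<^sup>2 / 2 / (1 - s * b / 3) * expectation (\<lambda>\<omega>. (X \<omega>)\<^sup>2))"
    by (rule exp_ge_add_one_self)
  also have "\<dots> \<le> exp (s * expectation X + s\<^sup>2 / 2 / (1 - s * b / 3) * v)"
  proof -
    have "0 \<le> s\<^sup>2 / 2 / (1 - s * b / 3)" using p by (intro divide_nonneg_pos) simp_all
    from mult_left_mono[OF v this] show ?thesis by simp
  qed
  finally have "expectation (\<lambda>\<omega>. exp (s * X \<omega>)) * exp (- s * expectation X)
      \<le> exp (s * expectation X + s\<^sup>2 / 2 / (1 - s * b / 3) * v) * exp (- s * expectation X)"
    by (rule mult_right_mono) simp
  then show "expectation (\<lambda>\<omega>. exp (s * (X \<omega> - expectation X))) \<le> exp (s\<^sup>2 * v / 2 / (1 - s * b / 3))"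
    unfolding eq integral_mult_left_zero by (simp add: exp_add[symmetric])
qed

text \<open>The exponential turns the centred sum into a product, and independence factorises its
  expectation into the one-variable bounds.\<close>

lemma (in prob_space)
  fixes X :: "'i \<Rightarrow> 'a \<Rightarrow> real"
  assumes I: "finite I" and indep: "indep_vars (\<lambda>_. borel) X I"
    and b: "\<And>i. i \<in> I \<Longrightarrow> AE \<omega> in M. \<bar>X i \<omega>\<bar> \<le> b"
    and v: "\<And>i. i \<in> I \<Longrightarrow> expectation (\<lambda>\<omega>. (X i \<omega>)\<^sup>2) \<le> v"
    and s: "0 \<le> s" "s * b < 3"
  shows bernstein_mgf_sum_integrable:
      "integrable M (\<lambda>\<omega>. exp (s * (\<Sum>i\<in>I. X i \<omega> - expectation (X i))))"
    and bernstein_mgf_sum: "expectation (\<lambda>\<omega>. exp (s * (\<Sum>i\<in>I. X i \<omega> - expectation (X i))))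
      \<le> exp (real (card I) * (s\<^sup>2 * v / 2 / (1 - s * b / 3)))"
proof -
  let ?E = "\<lambda>i \<omega>. exp (s * (X i \<omega> - expectation (X i)))"
  have meas: "X i \<in> borel_measurable M" if "i \<in> I" for i
    using indep that by (auto simp: indep_vars_def)
  have eq: "exp (s * (\<Sum>i\<in>I. X i \<omega> - expectation (X i))) = (\<Prod>i\<in>I. ?E i \<omega>)" for \<omega>
    by (simp add: sum_distrib_left exp_sum I)
  have ind: "indep_vars (\<lambda>_. borel) ?E I"
    by (rule indep_vars_compose2[OF indep]) measurable
  have int: "integrable M (?E i)" if "i \<in> I" for i
    by (rule bernstein_mgf_integrable[OF meas[OF that] b[OF that] v[OF that] s])
  show "integrable M (\<lambda>\<omega>. exp (s * (\<Sum>i\<in>I. X i \<omega> - expectation (X i))))"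
    unfolding eq by (rule indep_vars_integrable[OF I ind int])
  have "expectation (\<lambda>\<omega>. exp (s * (\<Sum>i\<in>I. X i \<omega> - expectation (X i)))) = (\<Prod>i\<in>I. expectation (?E i))"
    unfolding eq by (rule indep_vars_lebesgue_integral[OF I ind int])
  also have "\<dots> \<le> (\<Prod>i\<in>I. exp (s\<^sup>2 * v / 2 / (1 - s * b / 3)))"
  proof (rule prod_mono, rule conjI)
    fix i assume i: "i \<in> I"
    show "0 \<le> expectation (?E i)" by simp
    show "expectation (?E i) \<le> exp (s\<^sup>2 * v / 2 / (1 - s * b / 3))"
      by (rule bernstein_mgf[OF meas[OF i] b[OF i] v[OF i] s])
  qed
  also have "\<dots> = exp (real (card I) * (s\<^sup>2 * v / 2 / (1 - s * b / 3)))"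
    by (simp only: prod_constant exp_of_nat_mult)
  finally show "expectation (\<lambda>\<omega>. exp (s * (\<Sum>i\<in>I. X i \<omega> - expectation (X i))))
      \<le> exp (real (card I) * (s\<^sup>2 * v / 2 / (1 - s * b / 3)))" .
qed

section \<open>Moment generating functions of centred Gaussian variables\<close>

lemma normal_density_mgf:
  assumes "0 < \<sigma>"
  shows "has_bochner_integral lborel (\<lambda>x. normal_density 0 \<sigma> x * exp (t * x)) (exp (t\<^sup>2 * \<sigma>\<^sup>2 / 2))"
proof -
  \<comment> \<open>Completing the square: the exponential tilt moves the mean to
    \<open>\<sigma>\<^sup>2 * t\<close> and leaves a constant factor, so the integral is that
    constant.\<close>
  have "normal_density 0 \<sigma> x * exp (t * x) = normal_density (\<sigma>\<^sup>2 * t) \<sigma> x * exp (t\<^sup>2 * \<sigma>\<^sup>2 / 2)" for x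
  proof -
    have "- x\<^sup>2 / (2 * \<sigma>\<^sup>2) + t * x = - (x - \<sigma>\<^sup>2 * t)\<^sup>2 / (2 * \<sigma>\<^sup>2) + t\<^sup>2 * \<sigma>\<^sup>2 / 2"
      using assms by (simp add: field_simps power2_eq_square)
    then show ?thesis
      by (simp add: normal_density_def exp_add[symmetric])
  qed
  moreover have "has_bochner_integral lborel
      (\<lambda>x. normal_density (\<sigma>\<^sup>2 * t) \<sigma> x * exp (t\<^sup>2 * \<sigma>\<^sup>2 / 2)) (1 * exp (t\<^sup>2 * \<sigma>\<^sup>2 / 2))"
    using assms by (intro has_bochner_integral_mult_left) (auto simp: has_bochner_integral_iff)
  ultimately show ?thesis by simp
qed

lemma (in prob_space)
  assumes U[measurable]: "U \<in> borel_measurable M" and law: "gaussian_law (distr M borel U)"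
    and mean: "expectation U = 0"
  shows gaussian_law_power2_integrable: "integrable M (\<lambda>\<omega>. (U \<omega>)\<^sup>2)"
    and gaussian_law_mgf_integrable: "integrable M (\<lambda>\<omega>. exp (t * U \<omega>))"
    and gaussian_law_mgf: "expectation (\<lambda>\<omega>. exp (t * U \<omega>)) = exp (t\<^sup>2 * expectation (\<lambda>\<omega>. (U \<omega>)\<^sup>2) / 2)"
proof -
  have "integrable M (\<lambda>\<omega>. (U \<omega>)\<^sup>2) \<and> integrable M (\<lambda>\<omega>. exp (t * U \<omega>)) \<and>
    expectation (\<lambda>\<omega>. exp (t * U \<omega>)) = exp (t\<^sup>2 * expectation (\<lambda>\<omega>. (U \<omega>)\<^sup>2) / 2)"
    using law unfolding gaussian_law_def
  proof (elim disjE exE conjE)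
    fix m \<sigma> :: real
    assume \<sigma>: "0 < \<sigma>" and "distr M borel U = density lborel (\<lambda>x. ennreal (normal_density m \<sigma> x))"
    \<comment> \<open>\<open>gaussian_law\<close> refers to the law on \<open>borel\<close>,
      \<open>distributed\<close> to the law on \<open>lborel\<close>; both have the same measurable
      sets.\<close>
    moreover have "distr M lborel U = distr M borel U" by (rule distr_cong) simp_all
    ultimately have D: "distributed M lborel U (normal_density m \<sigma>)"
      by (simp add: distributed_def)
    have [simp]: "m = 0" using normal_distributed_expectation[OF \<sigma> D] mean by simp
    have var: "expectation (\<lambda>\<omega>. (U \<omega>)\<^sup>2) = \<sigma>\<^sup>2"
      using normal_distributed_variance[OF \<sigma> D] mean by simp
    have "integrable M (\<lambda>\<omega>. (U \<omega>)\<^sup>2)"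
      using distributed_integrable[OF D, of "\<lambda>x. x\<^sup>2"] integrable_normal_moment[OF \<sigma>, of 0 2] by simp
    moreover have "integrable M (\<lambda>\<omega>. exp (t * U \<omega>))"
      using distributed_integrable[OF D, of "\<lambda>x. exp (t * x)"] normal_density_mgf[OF \<sigma>, of t]
      by (simp add: has_bochner_integral_iff)
    moreover have "expectation (\<lambda>\<omega>. exp (t * U \<omega>)) = exp (t\<^sup>2 * \<sigma>\<^sup>2 / 2)"
      using distributed_integral[OF D, of "\<lambda>x. exp (t * x)"] normal_density_mgf[OF \<sigma>, of t]
      by (simp add: has_bochner_integral_iff)
    ultimately show ?thesis by (simp add: var)
  next
    fix m :: real
    assume d: "distr M borel U = return borel m"
    \<comment> \<open>A point mass with mean zero sits at 0, so \<open>U\<close> vanishes almost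
      surely and both sides of the formula are 1.\<close>
    have "AE x in distr M borel U. x = m" unfolding d by (subst AE_return) auto
    then have ae: "AE \<omega> in M. U \<omega> = m" by (rule AE_distrD[OF U])
    then have "expectation U = expectation (\<lambda>_. m)" by (intro integral_cong_AE) auto
    then have "m = 0" using mean by (simp add: prob_space)
    with ae have ae: "AE \<omega> in M. U \<omega> = 0" by simp
    have "integrable M (\<lambda>\<omega>. (U \<omega>)\<^sup>2) \<longleftrightarrow> integrable M (\<lambda>\<omega>. 0 :: real)"
      using ae by (intro integrable_cong_AE) auto
    moreover have "integrable M (\<lambda>\<omega>. exp (t * U \<omega>)) \<longleftrightarrow> integrable M (\<lambda>\<omega>. 1 :: real)"
      using ae by (intro integrable_cong_AE) auto
    moreover have "expectation (\<lambda>\<omega>. exp (t * U \<omega>)) = expectation (\<lambda>\<omega>. 1)"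
      using ae by (intro integral_cong_AE) auto
    moreover have "expectation (\<lambda>\<omega>. (U \<omega>)\<^sup>2) = expectation (\<lambda>\<omega>. 0)"
      using ae by (intro integral_cong_AE) auto
    ultimately show ?thesis by (simp add: prob_space)
  qed
  then show "integrable M (\<lambda>\<omega>. (U \<omega>)\<^sup>2)" "integrable M (\<lambda>\<omega>. exp (t * U \<omega>))"
    "expectation (\<lambda>\<omega>. exp (t * U \<omega>)) = exp (t\<^sup>2 * expectation (\<lambda>\<omega>. (U \<omega>)\<^sup>2) / 2)" by auto
qed


section \<open>Gaussian white noise\<close>

text \<open>Linearity of \<open>W\<close> in \<open>h\<close> is not part of
  \<open>brownian_process\<close>, so the difference is not replaced by \<open>W\<close> at
  \<open>h1 - h2\<close>. Instead, joint normality with coefficients 1 and -1 gives its law, and the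
  covariance gives its variance.\<close>

lemma
  assumes W: "brownian_process P N W" and h1: "h1 \<in> L2_space N" and h2: "h2 \<in> L2_space N"
  shows brownian_diff_mgf_integrable: "integrable P (\<lambda>\<omega>. exp (t * (W h1 \<omega> - W h2 \<omega>)))"
    and brownian_diff_mgf: "prob_space.expectation P (\<lambda>\<omega>. exp (t * (W h1 \<omega> - W h2 \<omega>)))
      = exp (t\<^sup>2 * (L2_norm N (\<lambda>y. h1 y - h2 y))\<^sup>2 / 2)"
proof -
  interpret prob_space P using W by (simp add: brownian_process_def)
  let ?U = "\<lambda>\<omega>. W h1 \<omega> - W h2 \<omega>"
  \<comment> \<open>Square integrability comes from normality; an equation for the variance alone
    would not give it when its value is 0.\<close>
  have L2: "W h \<in> L2_space P" if h: "h \<in> L2_space N" for h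
  proof -
    have "gaussian_pair P (W h) (W h)" and mean: "expectation (W h) = 0"
      using W h by (auto simp: brownian_process_def)
    then have m: "W h \<in> borel_measurable P"
      and "gaussian_law (distr P borel (\<lambda>\<omega>. 1 * W h \<omega> + 0 * W h \<omega>))"
      unfolding gaussian_pair_def by blast+
    then have law: "gaussian_law (distr P borel (W h))" by simp
    have "integrable P (\<lambda>\<omega>. (W h \<omega>)\<^sup>2)"
      by (rule gaussian_law_power2_integrable[OF m law mean])
    then show ?thesis using m by (simp add: L2_space_def)
  qed
  have norm: "(L2_norm P (W h))\<^sup>2 = (L2_norm N h)\<^sup>2" if h: "h \<in> L2_space N" for h
  proof -
    have "expectation (W h) = 0" "variance (W h) = (L2_norm N h)\<^sup>2"
      using W h unfolding brownian_process_def by blast+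
    then show ?thesis by (simp add: L2_norm_power2)
  qed
  have mean: "expectation (W h) = 0" and int: "integrable P (W h)" if h: "h \<in> L2_space N" for h
    using W h L2[OF h] unfolding brownian_process_def
    by (auto simp: L2_space_def intro: square_integrable_imp_integrable)
  have pair: "gaussian_pair P (W h1) (W h2)"
    and cov: "expectation (\<lambda>\<omega>. W h1 \<omega> * W h2 \<omega>) = (\<integral>y. h1 y * h2 y \<partial>N)"
    using W h1 h2 unfolding brownian_process_def by blast+
  have "gaussian_law (distr P borel (\<lambda>\<omega>. 1 * W h1 \<omega> + (-1) * W h2 \<omega>))"
    using pair unfolding gaussian_pair_def by blast
  then have law: "gaussian_law (distr P borel ?U)" by simp
  have m: "?U \<in> borel_measurable P"
    using L2_space_diff[OF L2[OF h1] L2[OF h2]] by (simp add: L2_space_def)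
  have mU: "expectation ?U = 0"
    using mean[OF h1] mean[OF h2] int[OF h1] int[OF h2] by simp
  \<comment> \<open>The same expansion of a squared difference is used twice, over \<open>P\<close>
    and over \<open>N\<close>, and the terms match one by one.\<close>
  have "expectation (\<lambda>\<omega>. (?U \<omega>)\<^sup>2) = (L2_norm N (\<lambda>y. h1 y - h2 y))\<^sup>2"
    using L2_norm_diff_power2[OF L2[OF h1] L2[OF h2]] L2_norm_diff_power2[OF h1 h2]
      norm[OF h1] norm[OF h2] cov by (simp add: L2_norm_power2)
  then show "integrable P (\<lambda>\<omega>. exp (t * ?U \<omega>))"
    "expectation (\<lambda>\<omega>. exp (t * ?U \<omega>)) = exp (t\<^sup>2 * (L2_norm N (\<lambda>y. h1 y - h2 y))\<^sup>2 / 2)"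
    using gaussian_law_mgf_integrable[OF m law mU] gaussian_law_mgf[OF m law mU] by simp_all
qed

text \<open>At scale \<open>c\<close> the Gaussian exponent is at most
  \<open>2 * r\<^sup>2 / (n * c\<^sup>2)\<close> times the squared distance to
  \<open>\<phi>0\<close>, and the penalty is \<open>\<xi> / c\<close> times it. The penalty wins as
  soon as \<open>2 * r\<^sup>2 \<le> \<xi> * c * n\<close>. At
  \<open>c = \<xi> * C\<tau> * r\<^sup>2 / n\<close> this follows from
  \<open>2 \<le> \<xi>\<^sup>2 * C\<tau>\<close>, the squared form of the condition on
  \<open>\<xi>\<close>.\<close>

lemma white_noise_net_bound:
  fixes \<xi> C\<tau> :: real
  assumes A: "L2_linear M N A" and inj: "L2_injective M N A"
    and Q: "L2_adjoint N M (L2_range M N A) (L2_inverse M N A) Q"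
    and G: "G \<subseteq> L2_space M" "finite G" and f: "f \<in> L2_space M"
    and \<phi>0: "\<phi>0 \<in> G" and near: "L2_norm M (\<lambda>x. f x - \<phi>0 x) \<le> \<delta>"
    and C\<tau>: "0 < C\<tau>" and \<xi>: "sqrt (2 / C\<tau>) \<le> \<xi>" and n: "1 \<le> n"
    and W: "brownian_process P N W"
    and fhat: "net_estimator P G (\<lambda>\<omega>. white_noise_risk M Q (white_noise_obs N n (A f) W \<omega>)) fhat"
  shows "(1 - 2 * \<xi>) * prob_space.expectation P (\<lambda>\<omega>. (L2_norm M (\<lambda>x. fhat \<omega> x - f x))\<^sup>2)
    \<le> (1 + 2 * \<xi>) * \<delta>\<^sup>2 + \<xi> * C\<tau> * (net_op_norm M N Q G)\<^sup>2 / n * ln (real (card G))"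
proof -
  interpret prob_space P using W by (simp add: brownian_process_def)
  define r where "r = net_op_norm M N Q G"
  define X where "X \<phi> \<omega> = 2 * (n powr (- 1 / 2) * W (Q \<phi>) \<omega> - n powr (- 1 / 2) * W (Q \<phi>0) \<omega>)
    - \<xi> * (L2_norm M (\<lambda>x. \<phi> x - \<phi>0 x))\<^sup>2" for \<phi> \<omega>
  let ?E = "expectation (\<lambda>\<omega>. (L2_norm M (\<lambda>x. fhat \<omega> x - f x))\<^sup>2)"
  have Qlin: "L2_linear M N Q" using Q by (simp add: L2_adjoint_def)
  have QL2: "Q \<phi> \<in> L2_space N" if "\<phi> \<in> G" for \<phi>
    using Qlin that G by (auto simp: L2_linear_def)
  have "0 < sqrt (2 / C\<tau>)" using C\<tau> by simp
  then have \<xi>0: "0 < \<xi>" using \<xi> by linarith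
  have "(sqrt (2 / C\<tau>))\<^sup>2 \<le> \<xi>\<^sup>2" using \<xi> C\<tau> by (intro power_mono) auto
  then have \<xi>2: "2 \<le> \<xi>\<^sup>2 * C\<tau>" using C\<tau> by (simp add: divide_le_eq)
  have n0: "0 < real n" using n by simp
  have npow: "(real n powr (- 1 / 2))\<^sup>2 = 1 / n"
    using n0 by (simp add: powr_minus powr_half_sqrt power_inverse) (simp add: divide_inverse)
  \<comment> \<open>The scale stays free because the selection lemma requires \<open>0 < c\<close>,
    whereas the intended value is 0 when \<open>r = 0\<close>.\<close>
  have *: "(1 - 2 * \<xi>) * ?E \<le> (1 + 2 * \<xi>) * \<delta>\<^sup>2 + c * ln (real (card G))"
    if c: "0 < c" "\<xi> * C\<tau> * r\<^sup>2 / n \<le> c" for c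
  proof -
    have "expectation (\<lambda>\<omega>. (1 - 2 * \<xi>) * (L2_norm M (\<lambda>x. fhat \<omega> x - f x))\<^sup>2)
      \<le> (1 + 2 * \<xi>) * \<delta>\<^sup>2 + c * ln (real (card G))"
    proof (rule expectation_selection_le[OF G(2) _ c(1),
          where D = "\<lambda>\<phi>. (1 - 2 * \<xi>) * (L2_norm M (\<lambda>x. \<phi> x - f x))\<^sup>2" and X = X])
      show "fhat \<in> P \<rightarrow>\<^sub>M count_space G" using fhat by (simp add: net_estimator_def)
      show "AE \<omega> in P. (1 - 2 * \<xi>) * (L2_norm M (\<lambda>x. fhat \<omega> x - f x))\<^sup>2
          \<le> (1 + 2 * \<xi>) * \<delta>\<^sup>2 + X (fhat \<omega>) \<omega>"
      proof (rule AE_I2)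
        fix \<omega> assume "\<omega> \<in> space P"
        then have "is_arg_min (white_noise_risk M Q (white_noise_obs N n (A f) W \<omega>)) (\<lambda>\<phi>. \<phi> \<in> G) (fhat \<omega>)"
          using fhat by (simp add: net_estimator_def)
        then have hG: "fhat \<omega> \<in> G" and min: "white_noise_risk M Q (white_noise_obs N n (A f) W \<omega>) (fhat \<omega>)
            \<le> white_noise_risk M Q (white_noise_obs N n (A f) W \<omega>) \<phi>0"
          using \<phi>0 by (auto simp: is_arg_min_linorder)
        show "(1 - 2 * \<xi>) * (L2_norm M (\<lambda>x. fhat \<omega> x - f x))\<^sup>2
            \<le> (1 + 2 * \<xi>) * \<delta>\<^sup>2 + X (fhat \<omega>) \<omega>"
          unfolding X_def
        proof (rule penalized_oracle_inequality[OF f _ _ near])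
          show "fhat \<omega> \<in> L2_space M" "\<phi>0 \<in> L2_space M" using hG \<phi>0 G by auto
          then show "- 2 * ((\<integral>x. f x * fhat \<omega> x \<partial>M) + n powr (- 1 / 2) * W (Q (fhat \<omega>)) \<omega>) + (L2_norm M (fhat \<omega>))\<^sup>2
            \<le> - 2 * ((\<integral>x. f x * \<phi>0 x \<partial>M) + n powr (- 1 / 2) * W (Q \<phi>0) \<omega>) + (L2_norm M \<phi>0)\<^sup>2"
            using min unfolding white_noise_risk_def white_noise_obs_def
            by (simp add: L2_adjoint_inverse_integral[OF A inj Q f])
        qed (use \<xi>0 in simp)
      qed
      fix \<phi> assume \<phi>: "\<phi> \<in> G"
      let ?w = "L2_norm M (\<lambda>x. \<phi> x - \<phi>0 x)" and ?s = "L2_norm N (\<lambda>y. Q \<phi> y - Q \<phi>0 y)"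
      let ?t = "2 * n powr (- 1 / 2) / c"
      \<comment> \<open>The noise enters through the Gaussian exponential at parameter
        \<open>?t\<close>; the penalty is a deterministic factor.\<close>
      have eq: "exp (X \<phi> \<omega> / c) = exp (?t * (W (Q \<phi>) \<omega> - W (Q \<phi>0) \<omega>)) * exp (- (\<xi> * ?w\<^sup>2 / c))" for \<omega>
        by (simp add: X_def exp_add[symmetric] diff_divide_distrib add_divide_distrib algebra_simps)
      show "integrable P (\<lambda>\<omega>. exp (X \<phi> \<omega> / c))"
        unfolding eq by (intro integrable_mult_left brownian_diff_mgf_integrable[OF W QL2[OF \<phi>] QL2[OF \<phi>0]])
      have "expectation (\<lambda>\<omega>. exp (X \<phi> \<omega> / c)) = exp (?t\<^sup>2 * ?s\<^sup>2 / 2 - \<xi> * ?w\<^sup>2 / c)"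
        unfolding eq integral_mult_left_zero brownian_diff_mgf[OF W QL2[OF \<phi>] QL2[OF \<phi>0]]
        by (simp only: exp_add[symmetric] diff_conv_add_uminus)
      moreover have "?t\<^sup>2 * ?s\<^sup>2 / 2 \<le> \<xi> * ?w\<^sup>2 / c"
      proof -
        have "2 * r\<^sup>2 \<le> (\<xi>\<^sup>2 * C\<tau>) * r\<^sup>2" using \<xi>2 by (rule mult_right_mono) simp
        also have "\<dots> = \<xi> * (\<xi> * C\<tau> * r\<^sup>2 / n) * n" using n0 by (simp add: power2_eq_square)
        also have "\<dots> \<le> \<xi> * c * n" using c \<xi>0 n0 by (intro mult_right_mono mult_left_mono) auto
        finally have rc: "2 * r\<^sup>2 \<le> \<xi> * c * n" .
        have "?t\<^sup>2 * ?s\<^sup>2 / 2 = 2 * ?s\<^sup>2 / (n * c\<^sup>2)"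
          by (simp only: power_divide power_mult_distrib npow) simp
        also have "\<dots> \<le> 2 * (r\<^sup>2 * ?w\<^sup>2) / (n * c\<^sup>2)"
          unfolding r_def using n0 c
          by (intro divide_right_mono mult_left_mono net_op_norm_bound[OF Qlin G \<phi> \<phi>0]) auto
        also have "\<dots> = (2 * r\<^sup>2) * (?w\<^sup>2 / (n * c\<^sup>2))" by simp
        also have "\<dots> \<le> (\<xi> * c * n) * (?w\<^sup>2 / (n * c\<^sup>2))"
          using rc n0 by (intro mult_right_mono) auto
        also have "\<dots> = \<xi> * ?w\<^sup>2 / c" using n0 c by (simp add: power2_eq_square)
        finally show ?thesis .
      qed
      ultimately show "expectation (\<lambda>\<omega>. exp (X \<phi> \<omega> / c)) \<le> 1" by simp
    qed
    then show ?thesis by simp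
  qed
  show ?thesis
  proof (cases "r = 0")
    case False
    then have "0 < \<xi> * C\<tau> * r\<^sup>2 / n" using \<xi>0 C\<tau> n0 by simp
    from *[OF this] show ?thesis by (simp add: r_def)
  next
    case True
    \<comment> \<open>Here the process vanishes almost surely, so every positive scale is admissible.\<close>
    have "0 < card G" using G \<phi>0 by (auto simp: card_gt_0_iff)
    then have L: "0 \<le> ln (real (card G))" by simp
    have "(1 - 2 * \<xi>) * ?E \<le> (1 + 2 * \<xi>) * \<delta>\<^sup>2"
    proof (rule field_le_epsilon)
      fix e :: real assume e: "0 < e"
      \<comment> \<open>The added 1 keeps the denominator positive when the net has a single
        point.\<close>
      let ?c = "e / (ln (real (card G)) + 1)"
      have "(1 - 2 * \<xi>) * ?E \<le> (1 + 2 * \<xi>) * \<delta>\<^sup>2 + ?c * ln (real (card G))"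
        using True e L by (intro *) auto
      moreover have "?c * ln (real (card G)) \<le> e"
        using e L by (simp add: field_simps)
      ultimately show "(1 - 2 * \<xi>) * ?E \<le> (1 + 2 * \<xi>) * \<delta>\<^sup>2 + e" by linarith
    qed
    then show ?thesis using True by (simp add: r_def)
  qed
qed


section \<open>Density estimation\<close>

lemma
  assumes D: "distributed P N Y (\<lambda>y. ennreal (g y))" and g: "g \<in> borel_measurable N"
    and pos: "AE y in N. 0 \<le> g y"
  shows distributed_AE_transfer: "(AE y in N. R y) \<Longrightarrow> AE \<omega> in P. R (Y \<omega>)"
    and distributed_integral_AE: "h \<in> borel_measurable N \<Longrightarrow>
      (\<integral>\<omega>. h (Y \<omega>) \<partial>P) = (\<integral>y. h y * g y \<partial>N)"
proof -
  show "AE \<omega> in P. R (Y \<omega>)" if "AE y in N. R y"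
  proof (rule AE_distrD[OF distributed_measurable[OF D]])
    show "AE y in distr P N Y. R y"
      unfolding distributed_distr_eq_density[OF D]
      using g that by (subst AE_density) auto
  qed
  assume h: "h \<in> borel_measurable N"
  \<comment> \<open>The density is nonnegative only almost everywhere, while the integral formula
    asks for a nonnegative function. Since \<open>ennreal\<close> sends negative reals to 0,
    truncation at 0 gives the same density.\<close>
  have D': "distributed P N Y (\<lambda>y. ennreal (max 0 (g y)))"
  proof -
    have "(\<lambda>y. ennreal (max 0 (g y))) = (\<lambda>y. ennreal (g y))"
      by (simp add: fun_eq_iff max_def ennreal_neg)
    then show ?thesis using D by simp
  qed
  have "(\<integral>\<omega>. h (Y \<omega>) \<partial>P) = (\<integral>y. max 0 (g y) * h y \<partial>N)"
    by (rule distributed_integral[OF D' h, symmetric]) simp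
  also have "\<dots> = (\<integral>y. h y * g y \<partial>N)"
    using pos g h by (intro integral_cong_AE) auto
  finally show "(\<integral>\<omega>. h (Y \<omega>) \<partial>P) = (\<integral>y. h y * g y \<partial>N)" .
qed

text \<open>Put \<open>x = \<xi> * C\<tau>\<close>. Bernstein's bound with multiplier
  \<open>s = 2 / (n * c) = 2 / (x * r\<^sup>2)\<close> is absorbed by the penalty once
  \<open>s * r\<^sup>2 * B \<le> \<xi> * (1 - s * (2 * B') / 3)\<close>. As \<open>1 \<le> r\<close>
  gives \<open>s \<le> 2 / x\<close>, this reduces to the quadratic inequality
  \<open>2 * B * C\<tau> \<le> x\<^sup>2 - 4 * B' / 3 * x\<close>, which the lower bound on
  \<open>\<xi>\<close> provides.\<close>

lemma density_net_bound:
  fixes \<xi> C\<tau> B B' :: real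
  assumes A: "L2_linear M N A" and inj: "L2_injective M N A"
    and Q: "L2_adjoint N M (L2_range M N A) (L2_inverse M N A) Q"
    and G: "G \<subseteq> L2_space M" "finite G" and f: "f \<in> L2_space M"
    and \<phi>0: "\<phi>0 \<in> G" and near: "L2_norm M (\<lambda>x. f x - \<phi>0 x) \<le> \<delta>"
    and C\<tau>: "0 < C\<tau>" and n: "1 \<le> n" and r: "1 \<le> net_op_norm M N Q G"
    and B: "0 < B" "Linf_norm N (A f) \<le> ereal B"
    and B': "0 < B'" "\<And>\<phi>. \<phi> \<in> G \<Longrightarrow> Linf_norm N (Q \<phi>) \<le> ereal B'"
    and \<xi>: "inverse C\<tau> * (4 * B' / 3 + sqrt (2 * (8 * B'\<^sup>2 / 9 + C\<tau> * B))) \<le> \<xi>"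
    and Y: "iid_sample P N n (A f) Y"
    and fhat: "net_estimator P G (\<lambda>\<omega>. density_risk M Q n (\<lambda>i. Y i \<omega>)) fhat"
  shows "(1 - 2 * \<xi>) * prob_space.expectation P (\<lambda>\<omega>. (L2_norm M (\<lambda>x. fhat \<omega> x - f x))\<^sup>2)
    \<le> (1 + 2 * \<xi>) * \<delta>\<^sup>2 + \<xi> * C\<tau> * (net_op_norm M N Q G)\<^sup>2 / n * ln (real (card G))"
proof -
  interpret prob_space P using Y by (simp add: iid_sample_def)
  define r where "r = net_op_norm M N Q G"
  define c where "c = \<xi> * C\<tau> * r\<^sup>2 / n"
  define I where "I \<phi> = (\<integral>y. Q \<phi> y * A f y \<partial>N)" for \<phi>
  define Z where "Z \<phi> \<omega> = (\<Sum>i=1..n. Q \<phi> (Y i \<omega>)) / n - I \<phi>" for \<phi> \<omega>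
  define X where "X \<phi> \<omega> = 2 * (Z \<phi> \<omega> - Z \<phi>0 \<omega>) - \<xi> * (L2_norm M (\<lambda>x. \<phi> x - \<phi>0 x))\<^sup>2" for \<phi> \<omega>
  have Qlin: "L2_linear M N Q" using Q by (simp add: L2_adjoint_def)
  have QL2: "Q \<phi> \<in> L2_space N" if "\<phi> \<in> G" for \<phi>
    using Qlin that G by (auto simp: L2_linear_def)
  have AL2: "A f \<in> L2_space N" using A f by (auto simp: L2_linear_def)
  then have g: "A f \<in> borel_measurable N" by (simp add: L2_space_def)
  have pos: "AE y in N. 0 \<le> A f y" using Y by (simp add: iid_sample_def prob_density_def)
  have D: "distributed P N (Y i) (\<lambda>y. ennreal (A f y))" if "i \<in> {1..n}" for i
    using Y that by (auto simp: iid_sample_def)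
  have indep: "indep_vars (\<lambda>_. N) Y {1..n}" using Y by (simp add: iid_sample_def)
  have n0: "0 < real n" using n by simp

  have x0: "4 * B' / 3 + sqrt (2 * (8 * B'\<^sup>2 / 9 + C\<tau> * B)) \<le> \<xi> * C\<tau>"
    using \<xi> C\<tau> by (simp add: field_simps)
  have s0: "0 < sqrt (2 * (8 * B'\<^sup>2 / 9 + C\<tau> * B))" using B B' C\<tau> by (simp add: add_nonneg_pos)
  have x1: "4 * B' / 3 < \<xi> * C\<tau>" using x0 s0 by linarith
  \<comment> \<open>Squaring \<open>x0\<close> gives this with \<open>8 * B' / 3\<close> in place of
    \<open>4 * B' / 3\<close>; the difference is nonnegative.\<close>
  have x2: "2 * B * C\<tau> \<le> (\<xi> * C\<tau>)\<^sup>2 - 4 * B' / 3 * (\<xi> * C\<tau>)"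
  proof -
    have "(sqrt (2 * (8 * B'\<^sup>2 / 9 + C\<tau> * B)))\<^sup>2 \<le> (\<xi> * C\<tau> - 4 * B' / 3)\<^sup>2"
      using x0 s0 by (intro power_mono) linarith+
    then have "16 * B'\<^sup>2 / 9 + 2 * C\<tau> * B \<le> (\<xi> * C\<tau> - 4 * B' / 3)\<^sup>2"
      using B B' C\<tau> by (simp add: add_nonneg_nonneg)
    moreover have "(\<xi> * C\<tau> - 4 * B' / 3)\<^sup>2 = (\<xi> * C\<tau>)\<^sup>2 - 8 * B' / 3 * (\<xi> * C\<tau>) + 16 * B'\<^sup>2 / 9"
      by (simp add: power2_eq_square field_simps)
    moreover have "0 \<le> 4 * B' / 3 * (\<xi> * C\<tau>)" using x1 B' by simp
    ultimately show ?thesis by (simp add: algebra_simps)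
  qed
  have xp: "0 < \<xi> * C\<tau>" using x1 B' by simp
  then have \<xi>0: "0 < \<xi>" using C\<tau> by (simp add: zero_less_mult_iff)
  have r1: "1 \<le> r\<^sup>2" using r unfolding r_def by (simp add: one_le_power)
  then have r0: "0 < r\<^sup>2" by linarith
  have c0: "0 < c" using xp r0 n0 by (simp add: c_def)
  \<comment> \<open>The 2 comes from \<open>X\<close>, the \<open>n\<close> from the empirical mean
    and the \<open>c\<close> from the scale, so that \<open>X \<phi> / c\<close> is \<open>s\<close>
    times a centred sum minus the penalty.\<close>
  define s where "s = 2 / (n * c)"
  have s0: "0 < s" using n0 c0 by (simp add: s_def)
  have seq: "s = 2 / (\<xi> * C\<tau>) / r\<^sup>2" using n0 by (simp add: s_def c_def)
  \<comment> \<open>Here the lower bound 1 on the operator norm over the net enters: it frees the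
    Bernstein denominator from \<open>r\<close> and \<open>n\<close>.\<close>
  have s1: "s \<le> 2 / (\<xi> * C\<tau>)"
  proof -
    have "2 / (\<xi> * C\<tau>) / r\<^sup>2 \<le> 2 / (\<xi> * C\<tau>) / 1"
      by (rule divide_left_mono[OF r1]) (use xp r0 in auto)
    then show ?thesis by (simp add: seq)
  qed
  have sb: "1 - 4 * B' / 3 / (\<xi> * C\<tau>) \<le> 1 - s * (2 * B') / 3"
    using mult_right_mono[OF s1, of "2 * B' / 3"] B' by (simp add: field_simps)
  have p1: "0 < 1 - 4 * B' / 3 / (\<xi> * C\<tau>)"
    using x1 xp by (simp add: divide_less_eq)
  have p: "0 < 1 - s * (2 * B') / 3" using sb p1 by linarith
  then have sb3: "s * (2 * B') < 3" by simp
  have key: "s * r\<^sup>2 * B / (1 - s * (2 * B') / 3) \<le> \<xi>"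
  proof -
    have "s * r\<^sup>2 * B * C\<tau> = 2 * B * C\<tau> / (\<xi> * C\<tau>)" using r0 by (simp add: seq)
    also have "\<dots> \<le> ((\<xi> * C\<tau>)\<^sup>2 - 4 * B' / 3 * (\<xi> * C\<tau>)) / (\<xi> * C\<tau>)"
      using x2 xp by (intro divide_right_mono) auto
    also have "\<dots> = \<xi> * (1 - 4 * B' / 3 / (\<xi> * C\<tau>)) * C\<tau>"
      using xp by (simp add: field_simps power2_eq_square)
    also have "\<dots> \<le> \<xi> * (1 - s * (2 * B') / 3) * C\<tau>"
      using sb \<xi>0 C\<tau> by (intro mult_right_mono mult_left_mono) auto
    finally have "s * r\<^sup>2 * B \<le> \<xi> * (1 - s * (2 * B') / 3)" using C\<tau> by simp
    then show ?thesis using p by (simp add: divide_le_eq)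
  qed

  have "expectation (\<lambda>\<omega>. (1 - 2 * \<xi>) * (L2_norm M (\<lambda>x. fhat \<omega> x - f x))\<^sup>2)
    \<le> (1 + 2 * \<xi>) * \<delta>\<^sup>2 + c * ln (real (card G))"
  proof (rule expectation_selection_le[OF G(2) _ c0,
        where D = "\<lambda>\<phi>. (1 - 2 * \<xi>) * (L2_norm M (\<lambda>x. \<phi> x - f x))\<^sup>2" and X = X])
    show "fhat \<in> P \<rightarrow>\<^sub>M count_space G" using fhat by (simp add: net_estimator_def)
    show "AE \<omega> in P. (1 - 2 * \<xi>) * (L2_norm M (\<lambda>x. fhat \<omega> x - f x))\<^sup>2
        \<le> (1 + 2 * \<xi>) * \<delta>\<^sup>2 + X (fhat \<omega>) \<omega>"
    proof (rule AE_I2)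
      fix \<omega> assume "\<omega> \<in> space P"
      then have "is_arg_min (density_risk M Q n (\<lambda>i. Y i \<omega>)) (\<lambda>\<phi>. \<phi> \<in> G) (fhat \<omega>)"
        using fhat by (simp add: net_estimator_def)
      then have hG: "fhat \<omega> \<in> G" and min: "density_risk M Q n (\<lambda>i. Y i \<omega>) (fhat \<omega>)
          \<le> density_risk M Q n (\<lambda>i. Y i \<omega>) \<phi>0"
        using \<phi>0 by (auto simp: is_arg_min_linorder)
      show "(1 - 2 * \<xi>) * (L2_norm M (\<lambda>x. fhat \<omega> x - f x))\<^sup>2
          \<le> (1 + 2 * \<xi>) * \<delta>\<^sup>2 + X (fhat \<omega>) \<omega>"
        unfolding X_def
      proof (rule penalized_oracle_inequality[OF f _ _ near])
        show "fhat \<omega> \<in> L2_space M" "\<phi>0 \<in> L2_space M" using hG \<phi>0 G by auto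
        then show "- 2 * ((\<integral>x. f x * fhat \<omega> x \<partial>M) + Z (fhat \<omega>) \<omega>) + (L2_norm M (fhat \<omega>))\<^sup>2
          \<le> - 2 * ((\<integral>x. f x * \<phi>0 x \<partial>M) + Z \<phi>0 \<omega>) + (L2_norm M \<phi>0)\<^sup>2"
          using min unfolding density_risk_def Z_def I_def
          by (simp add: L2_adjoint_inverse_integral[OF A inj Q f])
      qed (use \<xi>0 in simp)
    qed
    fix \<phi> assume \<phi>: "\<phi> \<in> G"
    let ?w = "L2_norm M (\<lambda>x. \<phi> x - \<phi>0 x)"
    define h where "h = (\<lambda>y. Q \<phi> y - Q \<phi>0 y)"
    have hL2: "h \<in> L2_space N" unfolding h_def by (intro L2_space_diff QL2 \<phi> \<phi>0)
    then have [measurable]: "h \<in> borel_measurable N" and h2: "integrable N (\<lambda>y. (h y)\<^sup>2)"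
      by (auto simp: L2_space_def)
    have Eh: "expectation (\<lambda>\<omega>. h (Y i \<omega>)) = I \<phi> - I \<phi>0" if i: "i \<in> {1..n}" for i
    proof -
      have "expectation (\<lambda>\<omega>. h (Y i \<omega>)) = (\<integral>y. h y * A f y \<partial>N)"
        by (rule distributed_integral_AE[OF D[OF i] g pos]) measurable
      also have "\<dots> = I \<phi> - I \<phi>0"
        using L2_space_integrable_mult[OF QL2[OF \<phi>] AL2] L2_space_integrable_mult[OF QL2[OF \<phi>0] AL2]
        unfolding h_def I_def left_diff_distrib by (rule Bochner_Integration.integral_diff)
      finally show ?thesis .
    qed
    \<comment> \<open>The bound \<open>B\<close> on the density of the observations passes from
      their law to \<open>N\<close>, where the operator norm over the net applies.\<close>
    have Eh2: "expectation (\<lambda>\<omega>. (h (Y i \<omega>))\<^sup>2) \<le> B * (r\<^sup>2 * ?w\<^sup>2)" if i: "i \<in> {1..n}" for i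
    proof -
      have bd: "AE y in N. (h y)\<^sup>2 * A f y \<le> B * (h y)\<^sup>2"
        using Linf_norm_AE_bound[OF B(2)]
        by eventually_elim (simp add: mult.commute mult_right_mono abs_le_iff)
      have "expectation (\<lambda>\<omega>. (h (Y i \<omega>))\<^sup>2) = (\<integral>y. (h y)\<^sup>2 * A f y \<partial>N)"
        by (rule distributed_integral_AE[OF D[OF i] g pos]) measurable
      also have "\<dots> \<le> (\<integral>y. B * (h y)\<^sup>2 \<partial>N)"
      proof (rule integral_mono_AE[OF _ _ bd])
        show "integrable N (\<lambda>y. (h y)\<^sup>2 * A f y)"
          by (rule Bochner_Integration.integrable_bound[of N "\<lambda>y. B * (h y)\<^sup>2"])
            (use h2 g bd pos B in \<open>auto elim!: eventually_elim2\<close>)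
      qed (use h2 in simp)
      also have "\<dots> = B * (L2_norm N h)\<^sup>2" by (simp add: L2_norm_power2)
      also have "\<dots> \<le> B * (r\<^sup>2 * ?w\<^sup>2)"
        unfolding h_def r_def using B by (intro mult_left_mono net_op_norm_bound[OF Qlin G \<phi> \<phi>0]) auto
      finally show ?thesis .
    qed
    have hb: "AE \<omega> in P. \<bar>h (Y i \<omega>)\<bar> \<le> 2 * B'" if i: "i \<in> {1..n}" for i
    proof (rule distributed_AE_transfer[OF D[OF i] g pos])
      show "AE y in N. \<bar>h y\<bar> \<le> 2 * B'"
        using Linf_norm_AE_bound[OF B'(2)[OF \<phi>]] Linf_norm_AE_bound[OF B'(2)[OF \<phi>0]]
        by eventually_elim (simp add: h_def abs_le_iff)
    qed
    have ind: "indep_vars (\<lambda>_. borel) (\<lambda>i \<omega>. h (Y i \<omega>)) {1..n}"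
      by (rule indep_vars_compose2[OF indep]) measurable
    let ?S = "\<lambda>\<omega>. \<Sum>i\<in>{1..n}. h (Y i \<omega>) - expectation (\<lambda>\<omega>. h (Y i \<omega>))"
    have Z: "Z \<phi> \<omega> - Z \<phi>0 \<omega> = ?S \<omega> / n" for \<omega>
    proof -
      have "?S \<omega> = (\<Sum>i\<in>{1..n}. Q \<phi> (Y i \<omega>) - Q \<phi>0 (Y i \<omega>) - (I \<phi> - I \<phi>0))"
        by (intro sum.cong refl) (simp add: Eh, simp add: h_def)
      also have "\<dots> = (\<Sum>i\<in>{1..n}. Q \<phi> (Y i \<omega>)) - (\<Sum>i\<in>{1..n}. Q \<phi>0 (Y i \<omega>)) - n * (I \<phi> - I \<phi>0)"
        by (simp only: sum_subtractf sum_constant card_atLeastAtMost) (simp add: right_diff_distrib)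
      also have "\<dots> = n * (Z \<phi> \<omega> - Z \<phi>0 \<omega>)"
        using n0 by (simp add: Z_def right_diff_distrib)
      finally show ?thesis using n0 by simp
    qed
    have eq: "exp (X \<phi> \<omega> / c) = exp (s * ?S \<omega>) * exp (- (\<xi> * ?w\<^sup>2 / c))" for \<omega>
      unfolding X_def Z exp_add[symmetric] s_def by (simp add: diff_divide_distrib)
    have "integrable P (\<lambda>\<omega>. exp (s * ?S \<omega>))"
      by (rule bernstein_mgf_sum_integrable[OF finite_atLeastAtMost ind hb Eh2 less_imp_le[OF s0] sb3])
    then show "integrable P (\<lambda>\<omega>. exp (X \<phi> \<omega> / c))"
      unfolding eq by (rule integrable_mult_left)
    have bern: "expectation (\<lambda>\<omega>. exp (s * ?S \<omega>))
        \<le> exp (n * (s\<^sup>2 * (B * (r\<^sup>2 * ?w\<^sup>2)) / 2 / (1 - s * (2 * B') / 3)))"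
      using bernstein_mgf_sum[OF finite_atLeastAtMost ind hb Eh2 less_imp_le[OF s0] sb3]
      by (simp only: card_atLeastAtMost diff_Suc_1)
    have "expectation (\<lambda>\<omega>. exp (X \<phi> \<omega> / c)) = expectation (\<lambda>\<omega>. exp (s * ?S \<omega>)) * exp (- (\<xi> * ?w\<^sup>2 / c))"
      unfolding eq by (rule integral_mult_left_zero)
    also have "\<dots> \<le> exp (n * (s\<^sup>2 * (B * (r\<^sup>2 * ?w\<^sup>2)) / 2 / (1 - s * (2 * B') / 3))) * exp (- (\<xi> * ?w\<^sup>2 / c))"
      by (rule mult_right_mono[OF bern]) simp
    also have "\<dots> = exp (n * (s\<^sup>2 * (B * (r\<^sup>2 * ?w\<^sup>2)) / 2 / (1 - s * (2 * B') / 3)) - \<xi> * ?w\<^sup>2 / c)"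
      by (simp only: exp_add[symmetric] diff_conv_add_uminus)
    also have "\<dots> \<le> 1"
    proof -
      \<comment> \<open>Since \<open>n * s / 2 = 1 / c\<close>, exponent and penalty share the
        factor \<open>?w\<^sup>2 / c\<close>, and \<open>key\<close> compares what remains.\<close>
      have "n * (s\<^sup>2 * (B * (r\<^sup>2 * ?w\<^sup>2)) / 2 / (1 - s * (2 * B') / 3))
          = (n * s / 2) * ?w\<^sup>2 * (s * r\<^sup>2 * B / (1 - s * (2 * B') / 3))"
        by (simp add: power2_eq_square)
      also have "\<dots> \<le> (n * s / 2) * ?w\<^sup>2 * \<xi>"
        using key s0 by (intro mult_left_mono) auto
      also have "\<dots> = \<xi> * ?w\<^sup>2 / c" using n0 by (simp add: s_def)
      finally show ?thesis by simp
    qed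
    finally show "expectation (\<lambda>\<omega>. exp (X \<phi> \<omega> / c)) \<le> 1" .
  qed
  then show ?thesis by (simp add: c_def r_def)
qed

section \<open>Normalising the bounds and combining the two models\<close>

lemma oracle_bound_rescale:
  fixes E :: real
  assumes le: "(1 - 2 * \<xi>) * E \<le> (1 + 2 * \<xi>) * \<delta>\<^sup>2 + \<xi> * C * r\<^sup>2 / n * L"
    and \<xi>: "0 \<le> \<xi>" "\<xi> < 1 / 2" and C: "0 \<le> C" and n: "0 \<le> n"
  shows "E \<le> inverse (1 - 2 * \<xi>) * (1 + 2 * \<xi>) * \<delta>\<^sup>2
    + inverse (1 - 2 * \<xi>) * \<xi> * C * (r\<^sup>2 * (L + 1) / n)"
proof -
  have p: "0 < 1 - 2 * \<xi>" using \<xi> by simp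
  \<comment> \<open>A nonnegative coefficient allows \<open>L\<close> to be replaced by the larger
    \<open>L + 1\<close>.\<close>
  have "0 \<le> \<xi> * C * r\<^sup>2 / n" using \<xi> C n by simp
  then have "(1 - 2 * \<xi>) * E \<le> (1 + 2 * \<xi>) * \<delta>\<^sup>2 + \<xi> * C * r\<^sup>2 / n * (L + 1)"
    using le by (simp add: distrib_left)
  then have "inverse (1 - 2 * \<xi>) * ((1 - 2 * \<xi>) * E)
      \<le> inverse (1 - 2 * \<xi>) * ((1 + 2 * \<xi>) * \<delta>\<^sup>2 + \<xi> * C * r\<^sup>2 / n * (L + 1))"
    using p by (intro mult_left_mono) auto
  also have "inverse (1 - 2 * \<xi>) * ((1 - 2 * \<xi>) * E) = E"
    using p by simp
  finally show ?thesis by (simp add: algebra_simps add_divide_distrib)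
qed

theorem theorem1:
  fixes \<nu> :: "'y::topological_space measure"
    and A Q :: "(real ^ 'd \<Rightarrow> real) \<Rightarrow> ('y \<Rightarrow> real)"
    and F F\<delta> :: "(real ^ 'd \<Rightarrow> real) set"
    and f :: "real ^ 'd \<Rightarrow> real"
    and B2 \<delta> C\<tau> \<xi> C1 C2 :: real
    and n :: nat
  assumes borel_space: "sets \<nu> = sets (restrict_space borel (space \<nu>))"
    and A_linear: "L2_linear lebesgue \<nu> A"
    and A_injective: "L2_injective lebesgue \<nu> A"
    and Q_adjoint: "L2_adjoint \<nu> lebesgue (L2_range lebesgue \<nu> A) (L2_inverse lebesgue \<nu> A) Q"
    and B2: "0 < B2"
    and F_L2: "F \<subseteq> L2_space lebesgue"
    and F_bounded: "\<forall>g\<in>F. L2_norm lebesgue g \<le> B2"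
    and delta: "0 < \<delta>"
    and net: "L2_net lebesgue \<delta> F F\<delta>"
    and net_finite: "finite F\<delta>"
    and C\<tau>: "0 < C\<tau>"
    and n: "1 \<le> n"
    and f: "f \<in> F"
  defines "C1 \<equiv> inverse (1 - 2 * \<xi>) * (1 + 2 * \<xi>)"
    and "C2 \<equiv> inverse (1 - 2 * \<xi>) * \<xi> * C\<tau>"
  shows
    "(\<forall>(P :: 'w measure) Y fhat Binf Binf'.
        (\<forall>g\<in>F. prob_density lebesgue g) \<longrightarrow>
        F\<delta> \<subseteq> F \<longrightarrow>
        1 \<le> net_op_norm lebesgue \<nu> Q F\<delta> \<longrightarrow>
        0 < Binf \<longrightarrow> (SUP g\<in>F. Linf_norm \<nu> (A g)) \<le> ereal Binf \<longrightarrow>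
        0 < Binf' \<longrightarrow> (SUP g\<in>F. Linf_norm \<nu> (Q g)) \<le> ereal Binf' \<longrightarrow>
        inverse C\<tau> * (4 * Binf' / 3 + sqrt (2 * (8 * Binf'\<^sup>2 / 9 + C\<tau> * Binf))) \<le> \<xi> \<longrightarrow>
        \<xi> < 1 / 2 \<longrightarrow>
        iid_sample P \<nu> n (A f) Y \<longrightarrow>
        net_estimator P F\<delta> (\<lambda>\<omega>. density_risk lebesgue Q n (\<lambda>i. Y i \<omega>)) fhat \<longrightarrow>
        prob_space.expectation P (\<lambda>\<omega>. (L2_norm lebesgue (\<lambda>x. fhat \<omega> x - f x))\<^sup>2)
          \<le> C1 * \<delta>\<^sup>2 + C2 * ((net_op_norm lebesgue \<nu> Q F\<delta>)\<^sup>2 * (ln (real (card F\<delta>)) + 1) / real n))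
     \<and>
     (\<forall>(P :: 'v measure) W fhat.
        sqrt (2 / C\<tau>) \<le> \<xi> \<longrightarrow>
        \<xi> < 1 / 2 \<longrightarrow>
        brownian_process P \<nu> W \<longrightarrow>
        net_estimator P F\<delta> (\<lambda>\<omega>. white_noise_risk lebesgue Q (white_noise_obs \<nu> n (A f) W \<omega>)) fhat \<longrightarrow>
        prob_space.expectation P (\<lambda>\<omega>. (L2_norm lebesgue (\<lambda>x. fhat \<omega> x - f x))\<^sup>2)
          \<le> C1 * \<delta>\<^sup>2 + C2 * ((net_op_norm lebesgue \<nu> Q F\<delta>)\<^sup>2 * (ln (real (card F\<delta>)) + 1) / real n))"
proof -
  have G: "F\<delta> \<subseteq> L2_space lebesgue" using net by (simp add: L2_net_def)
  have fL2: "f \<in> L2_space lebesgue" using f F_L2 by blast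
  obtain \<phi>0 where \<phi>0: "\<phi>0 \<in> F\<delta>" and near: "L2_norm lebesgue (\<lambda>x. f x - \<phi>0 x) \<le> \<delta>"
    using net f unfolding L2_net_def by blast
  show ?thesis
    unfolding C1_def C2_def
  proof (intro conjI allI impI, goal_cases)
    case (1 P Y fhat Binf Binf')
    have A: "Linf_norm \<nu> (A f) \<le> ereal Binf"
      using SUP_upper[OF f, of "\<lambda>g. Linf_norm \<nu> (A g)"] 1(5) by (rule order_trans)
    \<comment> \<open>The net lies in \<open>F\<close> in this model, so the supremum over
      \<open>F\<close> also controls \<open>Q\<close> at the points of the net.\<close>
    have Q: "Linf_norm \<nu> (Q \<phi>) \<le> ereal Binf'" if "\<phi> \<in> F\<delta>" for \<phi>
    proof -
      have "\<phi> \<in> F" using 1(2) that by blast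
      from SUP_upper[OF this, of "\<lambda>g. Linf_norm \<nu> (Q g)"] 1(7) show ?thesis by (rule order_trans)
    qed
    have "0 \<le> inverse C\<tau> * (4 * Binf' / 3 + sqrt (2 * (8 * Binf'\<^sup>2 / 9 + C\<tau> * Binf)))"
      using C\<tau> 1(4,6) by simp
    \<comment> \<open>The sign of \<open>\<xi>\<close> is read off from its lower bound.\<close>
    then have "0 \<le> \<xi>" using 1(8) by linarith
    then show ?case
      using density_net_bound[OF A_linear A_injective Q_adjoint G net_finite fL2 \<phi>0 near C\<tau> n 1(3,4) A
          1(6) Q 1(8,10,11)] 1(9) C\<tau>
      by (intro oracle_bound_rescale) simp_all
  next
    case (2 P W fhat)
    have "0 \<le> sqrt (2 / C\<tau>)" using C\<tau> by simp
    then have "0 \<le> \<xi>" using 2(1) by linarith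
    then show ?case
      using white_noise_net_bound[OF A_linear A_injective Q_adjoint G net_finite fL2 \<phi>0 near C\<tau> 2(1) n
          2(3,4)] 2(2) C\<tau>
      by (intro oracle_bound_rescale) simp_all
  qed
qed

end
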